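(* Let $C\subset\mathbb{R}^2$ be a circle centered at the origin $(0,0)$, let $\mathbf{x}_0$ be a point of $C$ lying on the $x$-axis, and let $U$ be an open neighborhood of $C$ with $C\subset U\subset \mathbb{R}^2\setminus\{(0,0)\}$. Let $a>0$ and let $g:U\times(-a,a)\to\mathbb{R}^2$ be continuous and such that (i) $g(\mathbf{r},0)=-\dfrac{\kappa}{\|\mathbf{r}\|^{\alpha+2}}\,\mathbf{r}$ for all $\mathbf{r}=(x,y)\in U$, where $\kappa>0$, $\alpha\ge 0$ and $\alpha\neq 1$ are constants; (ii) for each $\mu\in(-a,a)$, the map $\mathbf{r}\mapsto g(\mathbf{r},\mu)$ is $C^1$ on $U$; (iii) for all $\mu\in(-a,a)$, $g(\cdot,\mu)$ is invariant (as a vector field) under the reflection $\varphi(x,y)=(x,-y)$; that is, $\varphi(U)=U$ and $g(\varphi(\mathbf{r}),\mu)=\varphi(g(\mathbf{r},\mu))$ for all $\mathbf{r}\in U$. Then there is $\delta_0$ with $0<\delta_0<a$ such that for each $\mu\in(-\delta_0,\delta_0)$ there is a velocity $\mathbf{v}_\mu\in\mathbb{R}^2$ for which the solution $\mathbf{r}(t,\mathbf{x}_0,\mathbf{v}_\mu,\mu)$ of $\ddot{\mathbf{r}}=g(\mathbf{r},\mu)$ is periodic. Moreover, given any $\eta>0$, $\delta_0>0$ can be chosen (together with the velocities $\mathbf{v}_\mu$) such that, in addition, (1) for every $\mu\in(-\delta_0,\delta_0)$ the trace of the solution $\mathbf{r}(t,\mathbf{x}_0,\mathbf{v}_\mu,\mu)$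 is a simple closed curve which is symmetric with respect to the $x$-axis and encloses the origin; (2) all the velocities $\mathbf{v}_\mu$ are $\eta$-close, i.e. $\|\mathbf{v}_\mu-\mathbf{v}_{\mu'}\|<\eta$ for all $\mu,\mu'\in(-\delta_0,\delta_0)$.
   Context: $\mathbf{r}(t,\mathbf{x},\mathbf{v},\mu)$ denotes the solution of the second order ODE $\ddot{\mathbf{r}}=g(\mathbf{r},\mu)$ with initial conditions $\mathbf{r}(0,\mathbf{x},\mathbf{v},\mu)=\mathbf{x}$ and $\dot{\mathbf{r}}(0,\mathbf{x},\mathbf{v},\mu)=\mathbf{v}$. The trace of a solution is its image in $\mathbb{R}^2$. A simple closed curve $S\subset\mathbb{R}^2$ encloses a point $p\notin S$ if $p$ belongs to the bounded component of $\mathbb{R}^2\setminus S$. *)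

theory Defs
  imports "HOL-Analysis.Analysis"
begin

definition reflect_x :: "real^2 \<Rightarrow> real^2" where
  "reflect_x r = vector [r $ 1, - (r $ 2)]"

definition C1_on :: "(real^2 \<Rightarrow> real^2) \<Rightarrow> (real^2) set \<Rightarrow> bool" where
  "C1_on f U \<longleftrightarrow>
     (\<exists>f' :: real^2 \<Rightarrow> ((real^2) \<Rightarrow>\<^sub>L (real^2)).
        (\<forall>r\<in>U. (f has_derivative blinfun_apply (f' r)) (at r)) \<and> continuous_on U f')"

text \<open>
  \<open>solves_ivp U F x v r\<close> says that \<open>r\<close> is a solution, defined for all times and with values in
  \<open>U\<close>, of the second order equation \<open>r'' = F r\<close> with initial position \<open>x\<close> and initial velocity \<open>v\<close>.
  When \<open>F\<close> is \<open>C\<^sup>1\<close> on the open set \<open>U\<close>, such an \<open>r\<close> is unique and is the maximal solution, so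
  an existential statement about \<open>r\<close> is a statement about the solution of the initial value problem.
\<close>
definition solves_ivp ::
  "(real^2) set \<Rightarrow> (real^2 \<Rightarrow> real^2) \<Rightarrow> real^2 \<Rightarrow> real^2 \<Rightarrow> (real \<Rightarrow> real^2) \<Rightarrow> bool" where
  "solves_ivp U F x v r \<longleftrightarrow>
     r 0 = x \<and>
     (\<exists>r'. r' 0 = v \<and>
        (\<forall>t. r t \<in> U \<and>
             (r has_vector_derivative r' t) (at t) \<and>
             (r' has_vector_derivative F (r t)) (at t)))"

definition periodic :: "(real \<Rightarrow> real^2) \<Rightarrow> bool" where
  "periodic r \<longleftrightarrow> (\<exists>T>0. \<forall>t. r (t + T) = r t)"

definition simple_closed_curve :: "(real^2) set \<Rightarrow> bool" where
  "simple_closed_curve S \<longleftrightarrow>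
     (\<exists>c. simple_path c \<and> pathfinish c = pathstart c \<and> path_image c = S)"

text \<open>The library's \<open>inside S\<close> is the union of the bounded components of the complement of \<open>S\<close>.\<close>
definition encloses :: "(real^2) set \<Rightarrow> real^2 \<Rightarrow> bool" where
  "encloses S p \<longleftrightarrow> p \<in> inside S"

end

theory Submission
  imports Defs
begin

text \<open>
  For \<open>\<mu> = 0\<close> the circle of radius \<open>\<rho>\<close> is an orbit; it leaves \<open>x0\<close> perpendicularly to the
  \<open>x\<close>-axis with speed \<open>q0\<close>, where \<open>q0\<^sup>2 = \<kappa> \<rho> powr - \<alpha>\<close>.  The periodic orbits for small \<open>\<mu>\<close> are found by
  shooting: by the reflection symmetry an orbit that leaves the \<open>x\<close>-axis perpendicularly, and meets
  it perpendicularly again after half a turn around the origin, closes up with its mirror image.  So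
  one has to find an initial speed \<open>q0 + s\<close> for which the radial velocity vanishes after half a turn.

  Close to the circle the angular velocity does not vanish, so the polar angle can replace time.
  The radius, the radial velocity \<open>p\<close> and the tangential velocity \<open>q\<close>, as functions of the angle, obey a
  first-order system on \<open>\<real>\<^sup>3\<close> (\<open>polar_field\<close>).  In this form half a turn is always the
  interval \<open>[0, \<pi>]\<close>, the circular orbit is an equilibrium for \<open>\<mu> = 0\<close>, and the trace of a
  \<open>2\<pi>\<close>-periodic solution is a polar graph, hence a simple closed curve around the origin
  (\<open>polar_graph\<close>).  Time is recovered by integrating the inverse of the angular velocity
  (\<open>time_change\<close>, \<open>solution_from_polar\<close>).

  The radial velocity after half a turn is \<open>2 S(\<pi>) s\<close>, up to an error that is small compared with
  \<open>s\<close> plus a constant times the distance between \<open>g(\<cdot>, \<mu>)\<close> and \<open>g(\<cdot>, 0)\<close>; here \<open>S\<close> solves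
  \<open>S'' = - (2 - \<alpha>) S\<close>, \<open>S(0) = 0\<close>, \<open>S'(0) = 1\<close> (\<open>adjoint_endpoint_estimate\<close>).  The number \<open>S(\<pi>)\<close>
  vanishes only if \<open>2 - \<alpha>\<close> is the square of a positive integer, and for \<open>\<alpha> \<ge> 0\<close> this means \<open>\<alpha> = 1\<close>,
  the Kepler problem, where all nearby orbits are closed (\<open>oscillator_solution\<close>).  Nothing is
  assumed about derivatives of \<open>g\<close> with respect to \<open>\<mu>\<close>, so the implicit function theorem does not
  apply.  But for a fixed small \<open>\<delta>\<close> and all small \<open>\<mu>\<close> the radial velocity after half a turn has
  opposite signs at \<open>s = - \<delta>\<close> and at \<open>s = \<delta>\<close>, and for each \<open>\<mu>\<close> it is continuous in \<open>s\<close>, because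
  \<open>g(\<cdot>, \<mu>)\<close> is locally Lipschitz.  The intermediate value theorem gives a suitable \<open>s\<close> with
  \<open>\<bar>s\<bar> \<le> \<delta>\<close> (\<open>periodic_polar_orbit\<close>), and the bound on \<open>s\<close> makes the velocities close to each other.
\<close>

section \<open>Globally Lipschitz differential equations\<close>

text \<open>
  At most one of the two integrals is nonzero, so this is the oriented integral from \<open>0\<close> to \<open>s\<close> for
  either sign of \<open>s\<close>.
\<close>
definition antideriv :: "(real \<Rightarrow> 'a::euclidean_space) \<Rightarrow> real \<Rightarrow> 'a" where
  "antideriv f s = integral {0..s} f - integral {s..0} f"

lemma antideriv_0 [simp]: "antideriv f 0 = 0"
  by (simp add: antideriv_def)

lemma has_vector_derivative_antideriv:
  fixes f :: "real \<Rightarrow> 'a::euclidean_space"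
  assumes "continuous_on UNIV f"
  shows "(antideriv f has_vector_derivative f s) (at s)"
proof -
  define N where "N = \<bar>s\<bar> + 1"
  have int: "f integrable_on {p..q}" for p q
    using assms continuous_on_subset integrable_continuous_real by blast
  have eq: "integral {-N..u} f - integral {-N..0} f = antideriv f u" if "u \<in> {-N<..<N}" for u
  proof (cases "u \<ge> 0")
    case True
    have "integral {-N..0} f + integral {0..u} f = integral {-N..u} f"
      using True that by (intro Henstock_Kurzweil_Integration.integral_combine int) auto
    moreover have "integral {u..0} f = 0"
      using True by (cases "u = 0") auto
    ultimately show ?thesis by (simp add: antideriv_def algebra_simps)
  next
    case False
    have "integral {-N..u} f + integral {u..0} f = integral {-N..0} f"
      using False that by (intro Henstock_Kurzweil_Integration.integral_combine int) auto
    then show ?thesis using False by (simp add: antideriv_def algebra_simps)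
  qed
  have "((\<lambda>u. integral {-N..u} f) has_vector_derivative f s) (at s within {-N..N})"
    by (rule integral_has_vector_derivative)
      (auto simp: N_def intro: continuous_on_subset[OF assms])
  then have "((\<lambda>u. integral {-N..u} f) has_vector_derivative f s) (at s)"
    by (subst (asm) at_within_interior) (auto simp: N_def)
  then have "((\<lambda>u. integral {-N..u} f - integral {-N..0} f) has_vector_derivative f s) (at s)"
    by (auto intro!: derivative_eq_intros)
  then show ?thesis
    by (rule has_vector_derivative_transform_within_open[of _ _ _ "{-N<..<N}"])
      (use eq in \<open>auto simp: N_def\<close>)
qed

lemma antideriv_diff:
  fixes f g :: "real \<Rightarrow> 'a::euclidean_space"
  assumes "continuous_on UNIV f" "continuous_on UNIV g"
  shows "antideriv (\<lambda>t. f t - g t) s = antideriv f s - antideriv g s"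
proof -
  have int: "h integrable_on {p..q}" if "continuous_on UNIV h" for p q and h :: "real \<Rightarrow> 'a"
    using that continuous_on_subset integrable_continuous_real by blast
  show ?thesis
    unfolding antideriv_def
    by (subst (1 2) Henstock_Kurzweil_Integration.integral_diff) (auto intro: int assms)
qed

lemma norm_antideriv_le_exp:
  fixes f :: "real \<Rightarrow> 'a::euclidean_space"
  assumes cont: "continuous_on UNIV f" and "K > 0"
    and bound: "\<And>t. norm (f t) \<le> C * exp (K * \<bar>t\<bar>)"
  shows "norm (antideriv f s) \<le> C / K * exp (K * \<bar>s\<bar>)"
proof (cases "s = 0")
  case True
  have "0 \<le> C * exp (K * \<bar>0\<bar>)" using bound[of 0] norm_ge_zero order_trans by blast
  then show ?thesis using True \<open>K > 0\<close> by simp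
next
  case False
  have C: "C \<ge> 0" using bound[of 0] norm_ge_zero order_trans[of 0 "norm (f 0)" C] by simp
  define \<sigma> where "\<sigma> = sgn s"
  have \<sigma>: "\<sigma> * \<bar>s\<bar> = s" "\<bar>\<sigma>\<bar> = 1" using False by (auto simp: \<sigma>_def sgn_if)
  have d: "((\<lambda>t. antideriv f (\<sigma> * t)) has_vector_derivative \<sigma> *\<^sub>R f (\<sigma> * t)) (at t)" for t
    by (rule vector_diff_chain_at[OF _ has_vector_derivative_antideriv[OF cont], unfolded o_def])
      (auto intro!: derivative_eq_intros)
  have e: "((\<lambda>t. C / K * exp (K * t)) has_vector_derivative C * exp (K * t)) (at t)" for t
    unfolding has_real_derivative_iff_has_vector_derivative[symmetric]
    using \<open>K > 0\<close> by (auto intro!: derivative_eq_intros)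
  have "norm (antideriv f (\<sigma> * \<bar>s\<bar>) - antideriv f (\<sigma> * 0)) \<le> C / K * exp (K * \<bar>s\<bar>) - C / K * exp (K * 0)"
  proof (rule differentiable_bound_general[where f' = "\<lambda>t. \<sigma> *\<^sub>R f (\<sigma> * t)" and \<phi>' = "\<lambda>t. C * exp (K * t)"])
    show "continuous_on {0..\<bar>s\<bar>} (\<lambda>t. antideriv f (\<sigma> * t))"
      using d has_vector_derivative_continuous by (blast intro: continuous_at_imp_continuous_on)
    show "continuous_on {0..\<bar>s\<bar>} (\<lambda>t. C / K * exp (K * t))"
      by (intro continuous_intros)
    show "norm (\<sigma> *\<^sub>R f (\<sigma> * t)) \<le> C * exp (K * t)" if "0 < t" "t < \<bar>s\<bar>" for t
      using bound[of "\<sigma> * t"] \<sigma> that by (simp add: abs_mult)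
  qed (use False d e in auto)
  moreover have "C / K \<ge> 0" using C \<open>K > 0\<close> by simp
  ultimately show ?thesis using \<sigma> by simp
qed

text \<open>
  The Picard operator acts on functions on the whole line that may grow exponentially.  It is
  transported to bounded continuous functions by the weight \<open>exp (- K \<bar>t\<bar>)\<close>; a growth rate \<open>K\<close> larger
  than \<open>2 L\<close> makes it a contraction, so no gluing of local solutions is needed.
\<close>
theorem picard_global:
  fixes F :: "real \<Rightarrow> 'a::euclidean_space \<Rightarrow> 'a"
  assumes cont: "continuous_on UNIV (\<lambda>(t, x). F t x)"
    and lip: "\<And>t x y. norm (F t x - F t y) \<le> L * norm (x - y)"
    and bounded: "\<And>t x. norm (F t x) \<le> M"
  obtains u where "u 0 = x0" "\<And>t. (u has_vector_derivative F t (u t)) (at t)"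
proof -
  \<comment> \<open>the weight gains a factor \<open>1 / K\<close> in each integration, and \<open>\<bar>L\<bar> / K \<le> 1 / 2\<close>\<close>
  define K where "K = 2 * \<bar>L\<bar> + 1"
  have K: "K > 0" by (simp add: K_def)
  have M: "M \<ge> 0" using bounded[of 0 0] norm_ge_zero order_trans by blast
  let ?w = "\<lambda>f t. exp (K * \<bar>t\<bar>) *\<^sub>R apply_bcontfun f t"
  define G where "G = (\<lambda>f t. F t (?w f t))"
  define Q where "Q = (\<lambda>f s. exp (- K * \<bar>s\<bar>) *\<^sub>R (x0 + antideriv (G f) s))"
  have contG: "continuous_on UNIV (G f)" for f
  proof -
    have "continuous_on UNIV (\<lambda>t. (\<lambda>(t, x). F t x) (t, ?w f t))"
      by (rule continuous_on_compose2[OF cont]) (intro continuous_intros, auto)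
    then show ?thesis by (simp add: G_def)
  qed
  have contA: "continuous_on UNIV (antideriv (G f))" for f
    using has_vector_derivative_antideriv[OF contG] has_vector_derivative_continuous
    by (blast intro: continuous_at_imp_continuous_on)
  have Q: "Q f \<in> bcontfun" for f
  proof -
    have "continuous_on UNIV (Q f)" unfolding Q_def
      by (intro continuous_intros contA)
    moreover have "norm (Q f s) \<le> norm x0 + M / K" for s
    proof -
      have "M \<le> M * exp (K * \<bar>t\<bar>)" for t
        using mult_left_mono[of 1 "exp (K * \<bar>t\<bar>)" M] M K by simp
      then have b: "norm (G f t) \<le> M * exp (K * \<bar>t\<bar>)" for t
        using bounded[of t "?w f t"] order_trans unfolding G_def by blast
      have "norm (Q f s) \<le> exp (- K * \<bar>s\<bar>) * (norm x0 + norm (antideriv (G f) s))"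
        unfolding Q_def by (simp add: norm_triangle_ineq)
      also have "\<dots> \<le> exp (- K * \<bar>s\<bar>) * (norm x0 + M / K * exp (K * \<bar>s\<bar>))"
        using norm_antideriv_le_exp[OF contG K(1) b] by (intro mult_left_mono add_mono) auto
      also have "\<dots> = exp (- K * \<bar>s\<bar>) * norm x0 + M / K * (exp (- K * \<bar>s\<bar>) * exp (K * \<bar>s\<bar>))"
        by (simp add: algebra_simps)
      also have "\<dots> \<le> norm x0 + M / K"
        using K by (simp add: mult_left_le_one_le flip: exp_add)
      finally show ?thesis .
    qed
    ultimately show ?thesis by (auto simp: bcontfun_def bounded_iff)
  qed
  define P where "P = (\<lambda>f. Bcontfun (Q f))"
  have P: "apply_bcontfun (P f) = Q f" for f
    unfolding P_def by (rule Bcontfun_inverse[OF Q])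
  have "dist (P f) (P g) \<le> 1 / 2 * dist f g" for f g
  proof (rule dist_bound)
    fix s
    have b: "norm (G f t - G g t) \<le> (\<bar>L\<bar> * dist f g) * exp (K * \<bar>t\<bar>)" for t
    proof -
      have "norm (G f t - G g t) \<le> L * norm (?w f t - ?w g t)"
        unfolding G_def by (rule lip)
      also have "\<dots> \<le> \<bar>L\<bar> * norm (?w f t - ?w g t)" by (intro mult_right_mono) auto
      also have "\<dots> = \<bar>L\<bar> * (exp (K * \<bar>t\<bar>) * dist (apply_bcontfun f t) (apply_bcontfun g t))"
        by (simp add: dist_norm flip: scaleR_diff_right)
      also have "\<dots> \<le> \<bar>L\<bar> * (exp (K * \<bar>t\<bar>) * dist f g)"
        by (intro mult_left_mono dist_bounded) auto
      finally show ?thesis by (simp add: algebra_simps)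
    qed
    have "dist (P f s) (P g s) = norm (exp (- K * \<bar>s\<bar>) *\<^sub>R antideriv (\<lambda>t. G f t - G g t) s)"
      unfolding P Q_def dist_norm antideriv_diff[OF contG contG]
      by (simp add: algebra_simps)
    also have "\<dots> = exp (- K * \<bar>s\<bar>) * norm (antideriv (\<lambda>t. G f t - G g t) s)" by simp
    also have "\<dots> \<le> exp (- K * \<bar>s\<bar>) * (\<bar>L\<bar> * dist f g / K * exp (K * \<bar>s\<bar>))"
      by (intro mult_left_mono norm_antideriv_le_exp b K) (auto intro!: continuous_intros contG)
    also have "\<dots> = (exp (- K * \<bar>s\<bar>) * exp (K * \<bar>s\<bar>)) * (\<bar>L\<bar> / K) * dist f g" by simp
    also have "\<dots> = (\<bar>L\<bar> / K) * dist f g" by (simp flip: exp_add)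
    also have "\<dots> \<le> 1 / 2 * dist f g"
      by (intro mult_right_mono) (auto simp: K_def field_simps)
    finally show "dist (P f s) (P g s) \<le> 1 / 2 * dist f g" .
  qed
  then obtain f where f: "P f = f"
    using banach_fix_type[of "1 / 2" P] by auto
  let ?u = "?w f"
  have u: "?u s = x0 + antideriv (G f) s" for s
  proof -
    have "?u s = exp (K * \<bar>s\<bar>) *\<^sub>R Q f s" using f P[of f] by simp
    also have "\<dots> = x0 + antideriv (G f) s" unfolding Q_def by (simp flip: exp_add)
    finally show ?thesis .
  qed
  show ?thesis
  proof (rule that[of ?u])
    show "?u 0 = x0" using u[of 0] by simp
    have "(?u has_vector_derivative G f t) (at t)" for t
    proof -
      have "((\<lambda>s. x0 + antideriv (G f) s) has_vector_derivative 0 + G f t) (at t)"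
        by (intro has_vector_derivative_add has_vector_derivative_const
            has_vector_derivative_antideriv contG)
      moreover have "(\<lambda>s. x0 + antideriv (G f) s) = ?u" using u by auto
      ultimately show ?thesis by simp
    qed
    then show "(?u has_vector_derivative F t (?u t)) (at t)" for t
      unfolding G_def by simp
  qed
qed

text \<open>
  A form of Gronwall's inequality that compares an exact with an approximate solution.  It is stated
  for the square of the norm because that is differentiable also where \<open>z\<close> vanishes.  The rate
  \<open>2 L + 1\<close> instead of \<open>2 L\<close> absorbs the mixed term \<open>2 \<epsilon> norm (z t)\<close>.
\<close>
lemma norm_growth:
  fixes z :: "real \<Rightarrow> 'a::real_inner"
  assumes deriv: "\<And>t. t \<in> {0..T} \<Longrightarrow> (z has_vector_derivative z' t) (at t)"
    and bound: "\<And>t. t \<in> {0..T} \<Longrightarrow> norm (z' t) \<le> L * norm (z t) + \<epsilon>"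
    and "L \<ge> 0" and t: "t \<in> {0..T}"
  shows "(norm (z t))\<^sup>2 \<le> exp ((2 * L + 1) * t) * ((norm (z 0))\<^sup>2 + \<epsilon>\<^sup>2)"
proof -
  define k where "k = 2 * L + 1"
  define h where "h = (\<lambda>s. exp (- k * s) * (z s \<bullet> z s + \<epsilon>\<^sup>2))"
  have "h t \<le> h 0"
  proof (rule DERIV_nonpos_imp_nonincreasing[of 0 t])
    fix s assume "0 \<le> s" "s \<le> t"
    then have s: "s \<in> {0..T}" using t by auto
    have zz: "((\<lambda>s. z s \<bullet> z s) has_real_derivative 2 * (z s \<bullet> z' s)) (at s)"
      using deriv[OF s] unfolding has_vector_derivative_def has_field_derivative_def
      by (auto intro!: derivative_eq_intros simp: inner_commute algebra_simps)
    have "(h has_real_derivative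
        exp (- k * s) * (2 * (z s \<bullet> z' s) - k * (z s \<bullet> z s + \<epsilon>\<^sup>2))) (at s)"
      unfolding h_def by (rule derivative_eq_intros zz refl)+ (simp add: algebra_simps)
    moreover have "2 * (z s \<bullet> z' s) - k * (z s \<bullet> z s + \<epsilon>\<^sup>2) \<le> 0"
    proof -
      have "z s \<bullet> z' s \<le> norm (z s) * norm (z' s)" by (rule norm_cauchy_schwarz)
      also have "\<dots> \<le> norm (z s) * (L * norm (z s) + \<epsilon>)"
        using bound[OF s] by (intro mult_left_mono) auto
      finally have "2 * (z s \<bullet> z' s) \<le> 2 * L * (norm (z s))\<^sup>2 + 2 * norm (z s) * \<epsilon>"
        by (simp add: power2_eq_square algebra_simps)
      also have "2 * norm (z s) * \<epsilon> \<le> (norm (z s))\<^sup>2 + \<epsilon>\<^sup>2" by (rule sum_squares_bound)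
      finally have "2 * (z s \<bullet> z' s) \<le> k * (norm (z s))\<^sup>2 + \<epsilon>\<^sup>2"
        by (simp add: k_def algebra_simps)
      also have "\<epsilon>\<^sup>2 \<le> k * \<epsilon>\<^sup>2"
        using mult_right_mono[of 1 k "\<epsilon>\<^sup>2"] \<open>L \<ge> 0\<close> by (simp add: k_def)
      finally show ?thesis by (simp add: dot_square_norm algebra_simps)
    qed
    ultimately show "\<exists>y. (h has_real_derivative y) (at s) \<and> y \<le> 0"
      by (meson exp_ge_zero mult_nonneg_nonpos)
  qed (use t in auto)
  then have "exp (k * t) * (exp (- k * t) * ((norm (z t))\<^sup>2 + \<epsilon>\<^sup>2)) \<le> exp (k * t) * ((norm (z 0))\<^sup>2 + \<epsilon>\<^sup>2)"
    by (simp add: h_def dot_square_norm)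
  then have "(norm (z t))\<^sup>2 + \<epsilon>\<^sup>2 \<le> exp (k * t) * ((norm (z 0))\<^sup>2 + \<epsilon>\<^sup>2)"
    by (simp flip: mult.assoc exp_add)
  moreover have "\<epsilon>\<^sup>2 \<ge> 0" by simp
  ultimately show ?thesis unfolding k_def by linarith
qed

text \<open>
  Applying the growth estimate to the difference, run forwards or backwards from \<open>t0\<close>, gives
  uniqueness in both time directions.
\<close>
lemma ode_unique:
  fixes F :: "real \<Rightarrow> 'a::real_inner \<Rightarrow> 'a"
  assumes lip: "\<And>t x y. norm (F t x - F t y) \<le> L * norm (x - y)"
    and u: "\<And>t. (u has_vector_derivative F t (u t)) (at t)"
    and v: "\<And>t. (v has_vector_derivative F t (v t)) (at t)"
    and eq: "u t0 = v t0"
  shows "u = v"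
proof
  fix t
  define \<sigma> :: real where "\<sigma> = (if t \<ge> t0 then 1 else -1)"
  define z where "z = (\<lambda>s. u (t0 + \<sigma> * s) - v (t0 + \<sigma> * s))"
  define z' where "z' = (\<lambda>s. \<sigma> *\<^sub>R (F (t0 + \<sigma> * s) (u (t0 + \<sigma> * s)) - F (t0 + \<sigma> * s) (v (t0 + \<sigma> * s))))"
  have \<sigma>: "\<bar>\<sigma>\<bar> = 1" "t0 + \<sigma> * \<bar>t - t0\<bar> = t" by (auto simp: \<sigma>_def)
  have shift: "((\<lambda>s. w (t0 + \<sigma> * s)) has_vector_derivative \<sigma> *\<^sub>R w' (t0 + \<sigma> * s)) (at s)"
    if "\<And>s. (w has_vector_derivative w' s) (at s)" for w w' :: "real \<Rightarrow> 'a" and s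
    by (rule vector_diff_chain_at[OF _ that, unfolded o_def]) (auto intro!: derivative_eq_intros)
  have "(norm (z \<bar>t - t0\<bar>))\<^sup>2 \<le> exp ((2 * \<bar>L\<bar> + 1) * \<bar>t - t0\<bar>) * ((norm (z 0))\<^sup>2 + 0\<^sup>2)"
  proof (rule norm_growth)
    show "(z has_vector_derivative z' s) (at s)" for s
      using shift[OF u, of s] shift[OF v, of s]
      by (auto simp: z_def z'_def scaleR_diff_right intro!: derivative_eq_intros)
    show "norm (z' s) \<le> \<bar>L\<bar> * norm (z s) + 0" for s
      using lip[of "t0 + \<sigma> * s" "u (t0 + \<sigma> * s)" "v (t0 + \<sigma> * s)"] \<sigma>(1)
        mult_right_mono[OF abs_ge_self[of L] norm_ge_zero[of "z s"]]
      by (auto simp: z_def z'_def)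
  qed auto
  then show "u t = v t" using \<sigma> eq by (simp add: z_def)
qed

section \<open>Polar coordinates in the plane\<close>

text \<open>
  The rotating frame.  The sign \<open>\<sigma>\<close> puts the angle \<open>0\<close> on the half of the \<open>x\<close>-axis that contains
  the initial point, so that both positions of \<open>x0\<close> are treated at once.
\<close>
definition er :: "real \<Rightarrow> real \<Rightarrow> real^2" where
  "er \<sigma> \<theta> = vector [\<sigma> * cos \<theta>, \<sigma> * sin \<theta>]"

definition et :: "real \<Rightarrow> real \<Rightarrow> real^2" where
  "et \<sigma> \<theta> = vector [- (\<sigma> * sin \<theta>), \<sigma> * cos \<theta>]"

lemma vec2_eq_iff: "x = y \<longleftrightarrow> x $ 1 = y $ 1 \<and> x $ 2 = y $ 2" for x y :: "real^2"
  by (simp add: vec_eq_iff forall_2)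

lemma inner_vec2: "x \<bullet> y = x $ 1 * y $ 1 + x $ 2 * y $ 2" for x y :: "real^2"
  by (simp add: inner_vec_def sum_2)

lemma frame_nth [simp]:
  "er \<sigma> \<theta> $ 1 = \<sigma> * cos \<theta>" "er \<sigma> \<theta> $ 2 = \<sigma> * sin \<theta>"
  "et \<sigma> \<theta> $ 1 = - (\<sigma> * sin \<theta>)" "et \<sigma> \<theta> $ 2 = \<sigma> * cos \<theta>"
  by (simp_all add: er_def et_def)

lemma reflect_x_nth [simp]: "reflect_x v $ 1 = v $ 1" "reflect_x v $ 2 = - v $ 2"
  by (simp_all add: reflect_x_def)

lemma frame_decomp:
  assumes "\<sigma>\<^sup>2 = 1"
  shows "v = (v \<bullet> er \<sigma> \<theta>) *\<^sub>R er \<sigma> \<theta> + (v \<bullet> et \<sigma> \<theta>) *\<^sub>R et \<sigma> \<theta>"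
proof -
  have *: "w = (w * (\<sigma> * c) + w' * (\<sigma> * s)) * (\<sigma> * c) + (w * (- (\<sigma> * s)) + w' * (\<sigma> * c)) * (- (\<sigma> * s))"
    "w' = (w * (\<sigma> * c) + w' * (\<sigma> * s)) * (\<sigma> * s) + (w * (- (\<sigma> * s)) + w' * (\<sigma> * c)) * (\<sigma> * c)"
    if "s\<^sup>2 + c\<^sup>2 = 1" for w w' c s :: real
    using that assms by algebra+
  show ?thesis
    unfolding vec2_eq_iff inner_vec2 vector_add_component vector_scaleR_component frame_nth real_scaleR_def
    using *[OF sin_cos_squared_add[of \<theta>]] by blast
qed

lemma norm_frame [simp]: "norm (er \<sigma> \<theta>) = \<bar>\<sigma>\<bar>" "norm (et \<sigma> \<theta>) = \<bar>\<sigma>\<bar>"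
proof -
  have "(\<sigma> * cos \<theta>) * (\<sigma> * cos \<theta>) + (\<sigma> * sin \<theta>) * (\<sigma> * sin \<theta>) = \<sigma>\<^sup>2 * ((cos \<theta>)\<^sup>2 + (sin \<theta>)\<^sup>2)"
    by (simp only: power2_eq_square algebra_simps)
  then show "norm (er \<sigma> \<theta>) = \<bar>\<sigma>\<bar>" "norm (et \<sigma> \<theta>) = \<bar>\<sigma>\<bar>"
    by (simp_all add: norm_eq_sqrt_inner inner_vec2 add.commute)
qed

lemma frame_periodic [simp]:
  "er \<sigma> (\<theta> + 2 * pi) = er \<sigma> \<theta>" "et \<sigma> (\<theta> + 2 * pi) = et \<sigma> \<theta>"
  by (simp_all add: vec2_eq_iff)

lemma reflect_frame: "reflect_x (er \<sigma> \<theta>) = er \<sigma> (- \<theta>)" "reflect_x (et \<sigma> \<theta>) = - et \<sigma> (- \<theta>)"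
  by (simp_all add: vec2_eq_iff)

lemma inner_reflect_x: "reflect_x v \<bullet> reflect_x w = v \<bullet> w"
  by (simp add: inner_vec2)

lemma reflect_x_scaleR: "reflect_x (c *\<^sub>R v) = c *\<^sub>R reflect_x v"
  by (simp add: vec2_eq_iff)

lemma has_vector_derivative_vec2:
  fixes f :: "real \<Rightarrow> real^2"
  assumes "((\<lambda>t. f t $ 1) has_real_derivative d $ 1) (at t)" "((\<lambda>t. f t $ 2) has_real_derivative d $ 2) (at t)"
  shows "(f has_vector_derivative d) (at t)"
proof -
  have "((\<lambda>t. f t $ i) has_derivative (\<lambda>x. x * d $ i)) (at t)" if "i \<in> {1, 2}" for i
    using assms that unfolding has_field_derivative_def mult_commute_abs by auto
  then have "(f has_derivative (\<lambda>x. x *\<^sub>R d)) (at t)"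
    by (subst has_derivative_componentwise_within)
      (auto simp: Basis_vec_def UNIV_2 cart_eq_inner_axis[symmetric])
  then show ?thesis by (simp add: has_vector_derivative_def)
qed

lemma frame_deriv:
  "(er \<sigma> has_vector_derivative et \<sigma> \<theta>) (at \<theta>)" "(et \<sigma> has_vector_derivative - er \<sigma> \<theta>) (at \<theta>)"
  by (rule has_vector_derivative_vec2; simp; auto intro!: derivative_eq_intros)+

lemma continuous_frame [continuous_intros]:
  assumes "continuous_on S f"
  shows "continuous_on S (\<lambda>x. er \<sigma> (f x))" "continuous_on S (\<lambda>x. et \<sigma> (f x))"
proof -
  have "continuous_on UNIV (er \<sigma>)" "continuous_on UNIV (et \<sigma>)"
    using frame_deriv[THEN has_vector_derivative_continuous]
    by (blast intro: continuous_at_imp_continuous_on)+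
  then show "continuous_on S (\<lambda>x. er \<sigma> (f x))" "continuous_on S (\<lambda>x. et \<sigma> (f x))"
    by (auto intro: continuous_on_compose2 assms)
qed

text \<open>
  The inverse function of the antiderivative \<open>\<tau>\<close> of \<open>\<nu>\<close> solves the autonomous equation
  \<open>\<psi>' = 1 / \<nu>(\<psi>)\<close>.  It is used with \<open>\<nu>\<close> the derivative of time with respect to the polar angle: then
  \<open>\<psi>\<close> is the angle at time \<open>t\<close>, and \<open>T = \<tau>(P)\<close> is the duration of a full turn.
\<close>
lemma time_change:
  fixes \<nu> :: "real \<Rightarrow> real"
  assumes cont: "continuous_on UNIV \<nu>" and "c > 0" and lower: "\<And>\<theta>. c \<le> \<nu> \<theta>"
    and "P > 0" and per: "\<And>\<theta>. \<nu> (\<theta> + P) = \<nu> \<theta>"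
  obtains \<psi> T where "\<psi> 0 = 0" "T > 0" "\<And>t. \<psi> (t + T) = \<psi> t + P" "surj \<psi>"
    "\<And>t. (\<psi> has_real_derivative 1 / \<nu> (\<psi> t)) (at t)"
proof -
  define \<tau> where "\<tau> = antideriv \<nu>"
  have d: "(\<tau> has_real_derivative \<nu> \<theta>) (at \<theta>)" for \<theta>
    using has_vector_derivative_antideriv[OF cont]
    by (simp add: \<tau>_def has_real_derivative_iff_has_vector_derivative)
  have growth: "c * (y - x) \<le> \<tau> y - \<tau> x" if "x \<le> y" for x y
  proof -
    have "\<tau> x - c * x \<le> \<tau> y - c * y"
    proof (rule DERIV_nonneg_imp_nondecreasing[OF that])
      fix s
      have "((\<lambda>s. \<tau> s - c * s) has_real_derivative \<nu> s - c) (at s)"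
        by (auto intro!: derivative_eq_intros d)
      then show "\<exists>y. ((\<lambda>s. \<tau> s - c * s) has_real_derivative y) (at s) \<and> 0 \<le> y"
        using lower[of s] by auto
    qed
    then show ?thesis by (simp add: algebra_simps)
  qed
  have mono: "\<tau> x < \<tau> y" if "x < y" for x y
    using growth[of x y] that \<open>c > 0\<close> mult_pos_pos[of c "y - x"] by linarith
  then have inj: "inj \<tau>" by (metis injI linorder_neqE_linordered_idom order_less_irrefl)
  have contau: "isCont \<tau> x" for x using d DERIV_isCont by blast
  have 0: "\<tau> 0 = 0" by (simp add: \<tau>_def)
  have surj: "\<exists>x. \<tau> x = y" for y
  proof -
    have "\<bar>y\<bar> / c * c = \<bar>y\<bar>" using \<open>c > 0\<close> by simp
    then have "\<tau> (- (\<bar>y\<bar> / c)) \<le> y" "y \<le> \<tau> (\<bar>y\<bar> / c)"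
      using growth[of 0 "\<bar>y\<bar> / c"] growth[of "- (\<bar>y\<bar> / c)" 0] \<open>c > 0\<close> 0
      by (auto simp: mult.commute)
    then show ?thesis
      using IVT[of \<tau> "- (\<bar>y\<bar> / c)" y "\<bar>y\<bar> / c"] contau \<open>c > 0\<close> by fastforce
  qed
  define \<psi> where "\<psi> = inv \<tau>"
  have \<tau>\<psi>: "\<tau> (\<psi> t) = t" for t using surj unfolding \<psi>_def by (metis f_inv_into_f rangeI)
  have \<psi>\<tau>: "\<psi> (\<tau> x) = x" for x unfolding \<psi>_def by (simp add: inj)
  show ?thesis
  proof (rule that[of \<psi> "\<tau> P"])
    show "\<psi> 0 = 0" using \<psi>\<tau>[of 0] 0 by simp
    show "\<tau> P > 0" using mono[of 0 P] 0 \<open>P > 0\<close> by simp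
    show "surj \<psi>" using \<psi>\<tau> by (metis surjI)
    show "\<psi> (t + \<tau> P) = \<psi> t + P" for t
    proof -
      have "((\<lambda>s. \<tau> (s + P) - \<tau> s) has_real_derivative \<nu> (s + P) - \<nu> s) (at s)" for s
        by (intro derivative_intros d, rule DERIV_chain2[OF d, of _ 1, simplified])
          (auto intro!: derivative_eq_intros)
      then have "(\<lambda>s. \<tau> (s + P) - \<tau> s) (\<psi> t) = (\<lambda>s. \<tau> (s + P) - \<tau> s) 0"
        using per by (intro DERIV_isconst_all) auto
      then have "\<tau> (\<psi> t + P) = t + \<tau> P" using \<tau>\<psi>[of t] 0 by simp
      then show ?thesis using \<psi>\<tau> by metis
    qed
    show "(\<psi> has_real_derivative 1 / \<nu> (\<psi> t)) (at t)" for t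
    proof -
      have "isCont \<psi> t"
        using isCont_inverse_function[of 1 "\<psi> t" \<psi> \<tau>] \<psi>\<tau> contau \<tau>\<psi> by auto
      then have "(\<psi> has_real_derivative inverse (\<nu> (\<psi> t))) (at t)"
        using lower[of "\<psi> t"] \<open>c > 0\<close> \<tau>\<psi>
        by (intro DERIV_inverse_function[OF d, where a = "t - 1" and b = "t + 1"]) auto
      then show ?thesis by (simp add: field_simps)
    qed
  qed
qed

lemma polar_representation:
  assumes "\<sigma>\<^sup>2 = 1"
  obtains \<theta> where "z = norm z *\<^sub>R er \<sigma> \<theta>"
proof (cases "z = 0")
  case False
  have \<sigma>: "\<sigma> * \<sigma> = 1" using assms by (simp add: power2_eq_square)
  let ?x = "\<sigma> * z $ 1 / norm z" and ?y = "\<sigma> * z $ 2 / norm z"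
  have n: "(norm z)\<^sup>2 = (z $ 1)\<^sup>2 + (z $ 2)\<^sup>2"
    unfolding power2_norm_eq_inner inner_vec2 by (simp add: power2_eq_square)
  have "?x\<^sup>2 + ?y\<^sup>2 = ((z $ 1)\<^sup>2 + (z $ 2)\<^sup>2) / (norm z)\<^sup>2"
    using assms by (simp add: power_mult_distrib power_divide add_divide_distrib)
  also have "\<dots> = 1" using False n[symmetric] by simp
  finally obtain \<theta> where "?x = cos \<theta>" "?y = sin \<theta>" using sincos_total_2pi by metis
  then have "\<sigma> * cos \<theta> = \<sigma> * \<sigma> * z $ 1 / norm z" "\<sigma> * sin \<theta> = \<sigma> * \<sigma> * z $ 2 / norm z"
    by (simp_all only: mult.assoc times_divide_eq_right flip: \<open>?x = cos \<theta>\<close> \<open>?y = sin \<theta>\<close>)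
  then have "z = norm z *\<^sub>R er \<sigma> \<theta>" using False \<sigma> by (simp add: vec2_eq_iff)
  then show ?thesis using that by blast
qed (use that in auto)

lemma er_eq_iff:
  assumes "\<sigma>\<^sup>2 = 1"
  shows "er \<sigma> \<theta> = er \<sigma> \<theta>' \<longleftrightarrow> (\<exists>n::int. \<theta> = \<theta>' + 2 * pi * n)"
proof -
  have "\<sigma> \<noteq> 0" using assms by auto
  then show ?thesis by (auto simp: vec2_eq_iff sin_cos_eq_iff[symmetric])
qed

lemma periodic_int:
  fixes f :: "real \<Rightarrow> 'a"
  assumes per: "\<And>\<theta>. f (\<theta> + P) = f \<theta>"
  shows "f (\<theta> + P * of_int n) = f \<theta>"
proof -
  have nat: "f (\<theta> + P * real n) = f \<theta>" for \<theta> and n :: nat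
  proof (induction n)
    case (Suc n)
    have "\<theta> + P * real (Suc n) = \<theta> + P * real n + P" by (simp add: algebra_simps)
    then show ?case using Suc per by metis
  qed simp
  show ?thesis
  proof (cases n)
    case (nonneg m)
    then show ?thesis using nat by simp
  next
    case (neg m)
    then have "real_of_int n = - real (Suc m)" by simp
    then have "P * (of_int n + real (Suc m)) = 0" by simp
    then have "\<theta> + P * of_int n + P * real (Suc m) = \<theta>"
      by (simp only: distrib_left add.assoc add_0_right)
    then show ?thesis using nat[of "\<theta> + P * of_int n" "Suc m"] by metis
  qed
qed

text \<open>
  Closed curves that are graphs over the polar angle; \<open>encloses\<close> and the other geometric claims about
  the periodic orbits depend only on this.
\<close>
locale polar_graph =
  fixes \<sigma> :: real and R :: "real \<Rightarrow> real"
  assumes sgn: "\<sigma>\<^sup>2 = 1" and cont: "continuous_on UNIV R" and pos: "\<And>\<theta>. R \<theta> > 0"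
    and per: "\<And>\<theta>. R (\<theta> + 2 * pi) = R \<theta>"
begin

definition X :: "real \<Rightarrow> real^2" where "X \<theta> = R \<theta> *\<^sub>R er \<sigma> \<theta>"

lemma abs_sgn [simp]: "\<bar>\<sigma>\<bar> = 1" using sgn by (simp add: abs_square_eq_1)

lemma norm_X [simp]: "norm (X \<theta>) = R \<theta>" using pos[of \<theta>] by (simp add: X_def)

lemma X_eqD: "X \<theta> = t *\<^sub>R X \<theta>' \<Longrightarrow> t > 0 \<Longrightarrow> er \<sigma> \<theta> = er \<sigma> \<theta>'"
proof -
  assume a: "X \<theta> = t *\<^sub>R X \<theta>'" "t > 0"
  then have "R \<theta> = t * R \<theta>'" using arg_cong[OF a(1), of norm] unfolding norm_scaleR norm_X by simp
  then have "(t * R \<theta>') *\<^sub>R er \<sigma> \<theta> = (t * R \<theta>') *\<^sub>R er \<sigma> \<theta>'" using a by (simp add: X_def)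
  then show ?thesis using a(2) pos[of \<theta>'] by simp
qed

lemma R_eq: "er \<sigma> \<theta> = er \<sigma> \<theta>' \<Longrightarrow> R \<theta> = R \<theta>'"
  unfolding er_eq_iff[OF sgn] using periodic_int[of R, OF per] by auto

lemma cont_X: "continuous_on S X"
  unfolding X_def by (intro continuous_intros continuous_on_subset[OF cont]) auto

lemma range_X: "range X = X ` {0..2 * pi}"
proof -
  have "X \<theta> \<in> X ` {0..2 * pi}" for \<theta>
  proof -
    define \<theta>' where "\<theta>' = 2 * pi * frac (\<theta> / (2 * pi))"
    have e: "er \<sigma> \<theta> = er \<sigma> \<theta>'"
      unfolding er_eq_iff[OF sgn]
      by (rule exI[of _ "\<lfloor>\<theta> / (2 * pi)\<rfloor>"]) (simp add: \<theta>'_def frac_def field_simps)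
    then have "X \<theta> = X \<theta>'" using R_eq[OF e] by (simp add: X_def)
    moreover have "\<theta>' \<in> {0..2 * pi}"
      using frac_lt_1[of "\<theta> / (2 * pi)"] by (simp add: \<theta>'_def)
    ultimately show ?thesis by blast
  qed
  then show ?thesis by auto
qed

lemma compact_range: "compact (range X)"
  unfolding range_X by (intro compact_continuous_image cont_X) simp

lemma simple_closed: "simple_closed_curve (range X)"
proof -
  let ?c = "\<lambda>s. X (2 * pi * s)"
  have "path ?c"
    unfolding path_def by (intro continuous_on_compose2[OF cont_X] continuous_intros) auto
  moreover have "loop_free ?c"
    unfolding loop_free_def
  proof (intro ballI impI)
    fix x y :: real assume xy: "x \<in> {0..1}" "y \<in> {0..1}" "?c x = ?c y"
    have "er \<sigma> (2 * pi * x) = er \<sigma> (2 * pi * y)"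
      by (rule X_eqD[of _ 1]) (use xy in auto)
    then obtain n :: int where "2 * pi * x = 2 * pi * y + 2 * pi * n"
      unfolding er_eq_iff[OF sgn] by blast
    then have "2 * pi * (x - y - n) = 0" by (simp add: algebra_simps)
    then have "x - y = n" by simp
    moreover have "-1 \<le> x - y" "x - y \<le> 1" using xy by auto
    ultimately have "n \<in> {-1..1}" by simp
    then have "n = -1 \<or> n = 0 \<or> n = 1" by auto
    then show "x = y \<or> x = 0 \<and> y = 1 \<or> x = 1 \<and> y = 0"
      using \<open>x - y = n\<close> xy by auto
  qed
  moreover have "pathfinish ?c = pathstart ?c"
    using per[of 0] frame_periodic(1)[of \<sigma> 0] by (simp add: pathfinish_def pathstart_def X_def)
  moreover have "path_image ?c = range X"
  proof -
    have "path_image ?c = X ` ((*) (2 * pi) ` {0..1})" by (simp only: path_image_def image_image)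
    also have "(*) (2 * pi) ` {0..1} = {0..2 * pi}" by (subst image_mult_atLeastAtMost) auto
    finally show ?thesis using range_X by simp
  qed
  ultimately show ?thesis unfolding simple_closed_curve_def simple_path_def by blast
qed

text \<open>
  The radius function descends to a continuous function of the direction, because radial projection
  is a homeomorphism from the compact curve onto the unit circle.  Comparing the norm of a point with
  the radius of the curve in its direction splits the complement of the curve into two disjoint open
  sets; the one that contains the origin is bounded and contains the component of the origin.
\<close>
lemma encloses_0: "encloses (range X) 0"
proof -
  let ?S = "range X" and ?n = "\<lambda>z::real^2. z /\<^sub>R norm z"
  have S0: "0 \<notin> ?S" using norm_X pos by (metis imageE norm_zero order_less_irrefl)
  have nX: "?n (X \<theta>) = er \<sigma> \<theta>" for \<theta> using pos[of \<theta>] by (simp add: X_def)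
  have cn: "continuous_on T ?n" if "0 \<notin> T" for T
    using that by (intro continuous_intros) auto
  have img: "?n ` ?S = sphere 0 1"
  proof -
    have "z \<in> range (er \<sigma>)" if "norm z = 1" for z
      using that polar_representation[OF sgn, of z] by (metis rangeI scaleR_one)
    then have "range (er \<sigma>) = sphere 0 1" by auto
    then show ?thesis unfolding image_image nX .
  qed
  moreover have "inj_on ?n ?S"
  proof (rule inj_onI)
    fix x y assume "x \<in> ?S" "y \<in> ?S" and e: "?n x = ?n y"
    then obtain a b where ab: "x = X a" "y = X b" by blast
    then have "er \<sigma> a = er \<sigma> b" using e nX by metis
    then show "x = y" unfolding ab X_def using R_eq by metis
  qed
  ultimately obtain k where k: "homeomorphism ?S (sphere 0 1) ?n k"
    using homeomorphism_compact[OF compact_range cn[OF S0]] by blast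
  have kX: "k (er \<sigma> \<theta>) = X \<theta>" for \<theta> using homeomorphism_apply1[OF k, of "X \<theta>"] nX by simp
  define f where "f = (\<lambda>z. norm z - norm (k (?n z)))"
  have unit: "?n ` (- {0}) \<subseteq> sphere 0 1"
  proof
    fix w assume "w \<in> ?n ` (- {0})"
    then obtain z where "z \<noteq> 0" "w = ?n z" by blast
    then show "w \<in> sphere 0 1" by simp
  qed
  have "continuous_on (- {0}) (\<lambda>z. k (?n z))"
    by (rule continuous_on_compose2[OF homeomorphism_cont2[OF k] cn unit]) simp
  then have cf: "continuous_on (- {0}) f"
    unfolding f_def by (intro continuous_intros)
  have fX: "f (t *\<^sub>R er \<sigma> \<theta>) = t - R \<theta>" if "t > 0" for t \<theta> using that by (simp add: f_def kX)
  obtain \<rho> where \<rho>: "\<rho> > 0" "\<And>\<theta>. \<rho> \<le> R \<theta>"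
  proof -
    obtain m where "\<And>\<theta>. R m \<le> R \<theta>"
      using continuous_attains_inf[OF compact_range _ continuous_on_norm[OF continuous_on_id]] by auto
    then show ?thesis using that[of "R m"] pos by simp
  qed
  \<comment> \<open>the direction of \<open>0\<close> is undefined, so a small ball is added to the inner set\<close>
  let ?W = "ball 0 \<rho> \<union> {z \<in> - {0}. f z < 0}" and ?V = "{z \<in> - {0}. 0 < f z}"
  have ray: "f z = norm z - R \<theta>" if "z = norm z *\<^sub>R er \<sigma> \<theta>" "z \<noteq> 0" for z \<theta>
    using fX[of "norm z" \<theta>] that by simp
  have "open {z \<in> - {0}. f z < 0}" "open ?V"
    using continuous_open_preimage[OF cf, of "{..<0}"] continuous_open_preimage[OF cf, of "{0<..}"]
    by (auto simp: vimage_def Int_def)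
  then have op: "open ?W" "open ?V" by auto
  have disj: "?W \<inter> ?V = {}"
  proof -
    have "f z < 0" if "z \<in> ball 0 \<rho>" "z \<noteq> 0" for z
    proof -
      obtain \<theta> where "z = norm z *\<^sub>R er \<sigma> \<theta>" by (rule polar_representation[OF sgn])
      then show ?thesis using ray[of z \<theta>] \<rho>(2)[of \<theta>] that by simp
    qed
    then show ?thesis by (auto simp: not_less order_less_imp_le) (meson order_less_asym)+
  qed
  have cover: "- ?S \<subseteq> ?W \<union> ?V"
  proof
    fix z assume z: "z \<in> - ?S"
    obtain \<theta> where \<theta>: "z = norm z *\<^sub>R er \<sigma> \<theta>" by (rule polar_representation[OF sgn])
    have "norm z \<noteq> R \<theta>"
    proof
      assume "norm z = R \<theta>"
      then have "z = X \<theta>" unfolding X_def by (subst \<theta>) (simp only:)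
      then show False using z by blast
    qed
    then show "z \<in> ?W \<union> ?V" using ray[OF \<theta>] \<rho>(1) by (cases "z = 0") auto
  qed
  let ?C = "connected_component_set (- ?S) 0"
  have "?W \<inter> ?C = {} \<or> ?V \<inter> ?C = {}"
    by (rule connectedD[OF connected_connected_component op])
      (use cover connected_component_subset[of "- ?S" 0] disj in blast)+
  moreover have "0 \<in> ?W \<inter> ?C" using \<rho>(1) S0 by (simp add: connected_component_refl)
  ultimately have CW: "?C \<subseteq> ?W" using cover connected_component_subset[of "- ?S" 0] by blast
  obtain B where B: "\<And>\<theta>. R \<theta> \<le> B"
    using compact_imp_bounded[OF compact_range] by (auto simp: bounded_iff)
  have "norm z \<le> B + \<rho>" if "z \<in> ?W" for z
  proof -
    obtain \<theta> where \<theta>: "z = norm z *\<^sub>R er \<sigma> \<theta>" by (rule polar_representation[OF sgn])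
    show ?thesis using ray[OF \<theta>] B[of \<theta>] that pos[of \<theta>] \<rho>(1) by auto
  qed
  then have "bounded ?W" by (rule boundedI)
  then have "bounded ?C" using CW bounded_subset by blast
  then show ?thesis using S0 by (simp add: encloses_def inside_def)
qed

lemma reflect_range:
  assumes "\<And>\<theta>. R (- \<theta>) = R \<theta>"
  shows "reflect_x ` range X = range X"
proof -
  have "reflect_x (X \<theta>) = X (- \<theta>)" for \<theta>
    by (simp add: X_def reflect_x_scaleR reflect_frame assms)
  then have "reflect_x ` range X = X ` range uminus" by (simp only: image_image)
  then show ?thesis by simp
qed

end

section \<open>Reversible systems\<close>

text \<open>
  If \<open>u\<close> is a solution then so is \<open>R (u (- t))\<close>.  Both agree at time \<open>0\<close>, hence \<open>u (- t) = R (u t)\<close>; then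
  \<open>u (- P) = R (u P) = u P\<close>, and by uniqueness the solution repeats itself after the time \<open>2 P\<close>.
\<close>
lemma reversible_periodic:
  fixes F :: "real \<Rightarrow> 'a::real_inner \<Rightarrow> 'a" and P :: real
  assumes lip: "\<And>t x y. norm (F t x - F t y) \<le> L * norm (x - y)"
    and per: "\<And>t x. F (t + 2 * P) x = F t x"
    and "bounded_linear R" and rev: "\<And>t x. F (- t) (R x) = - R (F t x)"
    and u: "\<And>t. (u has_vector_derivative F t (u t)) (at t)"
    and fixed: "R (u 0) = u 0" "R (u P) = u P"
  shows "u (- t) = R (u t)" "u (t + 2 * P) = u t"
proof -
  interpret R: bounded_linear R by fact
  have "u = (\<lambda>t. R (u (- t)))"
  proof (rule ode_unique[OF lip u, where ?t0.0 = 0])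
    fix t
    have "((\<lambda>t. u (- t)) has_vector_derivative - F (- t) (u (- t))) (at t)"
      using vector_diff_chain_at[OF has_vector_derivative_minus[OF has_vector_derivative_id] u, of t]
      by (simp add: o_def)
    then have "((\<lambda>t. R (u (- t))) has_vector_derivative R (- F (- t) (u (- t)))) (at t)"
      by (rule R.has_vector_derivative)
    then show "((\<lambda>t. R (u (- t))) has_vector_derivative F t (R (u (- t)))) (at t)"
      using rev[of "- t" "u (- t)"] by (simp add: R.neg)
  qed (use fixed in simp)
  then have sym: "u s = R (u (- s))" for s by metis
  then show "u (- t) = R (u t)" by (metis minus_minus)
  have "(\<lambda>t. u (t + 2 * P)) = u"
  proof (rule ode_unique[OF lip _ u, where ?t0.0 = "- P"])
    show "((\<lambda>t. u (t + 2 * P)) has_vector_derivative F t (u (t + 2 * P))) (at t)" for t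
    proof -
      have "((\<lambda>t. t + 2 * P) has_vector_derivative 1) (at t)"
        by (auto intro!: derivative_eq_intros)
      then show ?thesis
        using vector_diff_chain_at[OF _ u, of "\<lambda>t. t + 2 * P" 1 t] per[of t] by (simp add: o_def)
    qed
    have "u (- P) = u P" using sym[of "- P"] fixed(2) by simp
    moreover have "- P + 2 * P = P" by simp
    ultimately show "u (- P + 2 * P) = u (- P)" by simp
  qed
  then show "u (t + 2 * P) = u t" by (rule fun_cong)
qed

lemma half_period_bound:
  fixes u :: "real \<Rightarrow> 'a"
  assumes even: "\<And>t. u (- t) = R (u t)" and per: "\<And>t. u (t + 2 * P) = u t" and "P > 0"
    and half: "\<And>t. t \<in> {0..P} \<Longrightarrow> u t \<in> K" and inv: "\<And>x. x \<in> K \<Longrightarrow> R x \<in> K"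
  shows "u t \<in> K"
proof -
  define s where "s = 2 * P * frac (t / (2 * P))"
  have "t = s + 2 * P * of_int \<lfloor>t / (2 * P)\<rfloor>"
    using \<open>P > 0\<close> by (simp add: s_def frac_def field_simps)
  then have us: "u t = u s" using periodic_int[of u "2 * P", OF per] by metis
  have s: "0 \<le> s" "s \<le> 2 * P"
    using frac_lt_1[of "t / (2 * P)"] \<open>P > 0\<close> by (simp_all add: s_def)
  show ?thesis
  proof (cases "s \<le> P")
    case True
    then show ?thesis using us half s by simp
  next
    case False
    have "u (s - 2 * P) = u s" using per[of "s - 2 * P"] by simp
    then have "u t = R (u (2 * P - s))" using even[of "2 * P - s"] us by simp
    then show ?thesis using half[of "2 * P - s"] inv False s by auto
  qed
qed

lemma closest_point_cball_commute:
  fixes R :: "'a::euclidean_space \<Rightarrow> 'a"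
  assumes iso: "\<And>x y. dist (R x) (R y) = dist x y" and "\<And>x. R (R x) = x" and "R a = a" and "r \<ge> 0"
  shows "closest_point (cball a r) (R x) = R (closest_point (cball a r) x)"
proof (rule closest_point_unique[symmetric])
  let ?c = "closest_point (cball a r) x"
  have inv: "R y \<in> cball a r" if "y \<in> cball a r" for y using that iso[of a y] assms by simp
  have "?c \<in> cball a r" by (rule closest_point_in_set) (use \<open>r \<ge> 0\<close> in auto)
  then show "R ?c \<in> cball a r" by (rule inv)
  show "\<forall>z\<in>cball a r. dist (R x) (R ?c) \<le> dist (R x) z"
  proof
    fix z assume "z \<in> cball a r"
    then have "dist x ?c \<le> dist x (R z)" by (intro closest_point_le inv) auto
    then show "dist (R x) (R ?c) \<le> dist (R x) z" using iso[of x ?c] iso[of x "R z"] assms(2) by simp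
  qed
qed auto

section \<open>The equation of motion with the polar angle as independent variable\<close>

text \<open>
  The equation \<open>r'' = h r\<close> for the position \<open>\<rho> er\<close> and the velocity \<open>p er + q et\<close>, with derivatives
  taken with respect to the polar angle \<open>\<theta>\<close>.  The factor \<open>\<rho> / q\<close> is \<open>dt / d\<theta>\<close>; the terms \<open>q\<close> and \<open>- p\<close>
  come from the rotation of the frame.
\<close>
definition polar_field :: "(real^2 \<Rightarrow> real^2) \<Rightarrow> real \<Rightarrow> real \<Rightarrow> real \<times> real \<times> real \<Rightarrow> real \<times> real \<times> real" where
  "polar_field h \<sigma> \<theta> = (\<lambda>(\<rho>, p, q).
     (p * (\<rho> / q), q + \<rho> / q * (h (\<rho> *\<^sub>R er \<sigma> \<theta>) \<bullet> er \<sigma> \<theta>), - p + \<rho> / q * (h (\<rho> *\<^sub>R er \<sigma> \<theta>) \<bullet> et \<sigma> \<theta>)))"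

text \<open>
  The action on \<open>(\<rho>, p, q)\<close> of the reflection in the \<open>x\<close>-axis combined with time reversal.
\<close>
definition flip_p :: "real \<times> real \<times> real \<Rightarrow> real \<times> real \<times> real" where
  "flip_p = (\<lambda>(\<rho>, p, q). (\<rho>, - p, q))"

lemma polar_field_reversible:
  assumes "\<And>x. x \<in> U \<Longrightarrow> h (reflect_x x) = reflect_x (h x)" and "fst u *\<^sub>R er \<sigma> \<theta> \<in> U"
  shows "polar_field h \<sigma> (- \<theta>) (flip_p u) = - flip_p (polar_field h \<sigma> \<theta> u)"
proof -
  obtain \<rho> p q where u: "u = (\<rho>, p, q)" by (cases u)
  have e: "er \<sigma> (- \<theta>) = reflect_x (er \<sigma> \<theta>)" "et \<sigma> (- \<theta>) = - reflect_x (et \<sigma> \<theta>)"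
    by (simp_all add: reflect_frame)
  have "h (\<rho> *\<^sub>R er \<sigma> (- \<theta>)) = reflect_x (h (\<rho> *\<^sub>R er \<sigma> \<theta>))"
    using assms by (simp add: e u flip: reflect_x_scaleR)
  then show ?thesis
    by (simp add: polar_field_def flip_p_def u e inner_reflect_x)
qed

lemma solution_from_polar:
  fixes u :: "real \<Rightarrow> real \<times> real \<times> real"
  assumes \<sigma>: "\<sigma>\<^sup>2 = 1"
    and u: "\<And>\<theta>. (u has_vector_derivative polar_field h \<sigma> \<theta> (u \<theta>)) (at \<theta>)"
    and per: "\<And>\<theta>. u (\<theta> + 2 * pi) = u \<theta>"
    and "c > 0" and lower: "\<And>\<theta>. c \<le> fst (u \<theta>)"
    and q: "\<And>\<theta>. 0 < snd (snd (u \<theta>))" "\<And>\<theta>. snd (snd (u \<theta>)) \<le> C"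
    and U: "\<And>\<theta>. fst (u \<theta>) *\<^sub>R er \<sigma> \<theta> \<in> U"
  obtains r where
    "solves_ivp U h (fst (u 0) *\<^sub>R er \<sigma> 0) (fst (snd (u 0)) *\<^sub>R er \<sigma> 0 + snd (snd (u 0)) *\<^sub>R et \<sigma> 0) r"
    "periodic r" "range r = range (\<lambda>\<theta>. fst (u \<theta>) *\<^sub>R er \<sigma> \<theta>)"
proof -
  define R p q where "R = (\<lambda>\<theta>. fst (u \<theta>))" and "p = (\<lambda>\<theta>. fst (snd (u \<theta>)))" and "q = (\<lambda>\<theta>. snd (snd (u \<theta>)))"
  define \<nu> where "\<nu> = (\<lambda>\<theta>. R \<theta> / q \<theta>)"
  define X V where "X = (\<lambda>\<theta>. R \<theta> *\<^sub>R er \<sigma> \<theta>)" and "V = (\<lambda>\<theta>. p \<theta> *\<^sub>R er \<sigma> \<theta> + q \<theta> *\<^sub>R et \<sigma> \<theta>)"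
  note defs = R_def p_def q_def
  have qpos: "q \<theta> > 0" and Rpos: "R \<theta> > 0" for \<theta> using q(1)[of \<theta>] lower[of \<theta>] \<open>c > 0\<close> by (auto simp: defs)
  have field: "polar_field h \<sigma> \<theta> (u \<theta>) =
      (p \<theta> * \<nu> \<theta>, q \<theta> + \<nu> \<theta> * (h (X \<theta>) \<bullet> er \<sigma> \<theta>), - p \<theta> + \<nu> \<theta> * (h (X \<theta>) \<bullet> et \<sigma> \<theta>))" for \<theta>
    by (simp add: polar_field_def defs \<nu>_def X_def split: prod.split)
  have dR: "(R has_real_derivative p \<theta> * \<nu> \<theta>) (at \<theta>)"
    and dp: "(p has_real_derivative q \<theta> + \<nu> \<theta> * (h (X \<theta>) \<bullet> er \<sigma> \<theta>)) (at \<theta>)"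
    and dq: "(q has_real_derivative - p \<theta> + \<nu> \<theta> * (h (X \<theta>) \<bullet> et \<sigma> \<theta>)) (at \<theta>)" for \<theta>
    using bounded_linear.has_vector_derivative[OF bounded_linear_fst u[of \<theta>]]
      bounded_linear.has_vector_derivative[OF bounded_linear_compose[OF bounded_linear_fst bounded_linear_snd] u[of \<theta>]]
      bounded_linear.has_vector_derivative[OF bounded_linear_compose[OF bounded_linear_snd bounded_linear_snd] u[of \<theta>]]
    unfolding field has_real_derivative_iff_has_vector_derivative defs by simp_all
  have contR: "continuous_on UNIV R" "continuous_on UNIV q"
    using dR dq DERIV_isCont by (blast intro: continuous_at_imp_continuous_on)+
  have q0: "q \<theta> \<noteq> 0" for \<theta> using qpos[of \<theta>] by simp
  \<comment> \<open>position and velocity, with respect to the angle; division by \<open>\<nu> = dt / d\<theta>\<close> gives the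
    derivatives with respect to time\<close>
  have dX: "(X has_vector_derivative \<nu> \<theta> *\<^sub>R V \<theta>) (at \<theta>)" for \<theta>
  proof -
    have "R \<theta> = \<nu> \<theta> * q \<theta>" using q0[of \<theta>] by (simp add: \<nu>_def)
    then show ?thesis
      unfolding X_def V_def
      by (auto intro!: derivative_eq_intros dR frame_deriv simp: algebra_simps)
  qed
  have dV: "(V has_vector_derivative \<nu> \<theta> *\<^sub>R h (X \<theta>)) (at \<theta>)" for \<theta>
  proof -
    have "\<nu> \<theta> *\<^sub>R h (X \<theta>) = p \<theta> *\<^sub>R et \<sigma> \<theta> + (q \<theta> + \<nu> \<theta> * (h (X \<theta>) \<bullet> er \<sigma> \<theta>)) *\<^sub>R er \<sigma> \<theta>
        + (q \<theta> *\<^sub>R - er \<sigma> \<theta> + (- p \<theta> + \<nu> \<theta> * (h (X \<theta>) \<bullet> et \<sigma> \<theta>)) *\<^sub>R et \<sigma> \<theta>)"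
      by (subst frame_decomp[OF \<sigma>, of "h (X \<theta>)" \<theta>]) (simp add: algebra_simps)
    then show ?thesis
      unfolding V_def
      by (simp only:) (rule has_vector_derivative_add has_vector_derivative_scaleR dp dq frame_deriv)+
  qed
  have C: "C > 0" using q[of 0] by linarith
  obtain \<psi> T where \<psi>: "\<psi> 0 = 0" "T > 0" "\<And>t. \<psi> (t + T) = \<psi> t + 2 * pi" "surj \<psi>"
    "\<And>t. (\<psi> has_real_derivative 1 / \<nu> (\<psi> t)) (at t)"
  proof (rule time_change)
    show "continuous_on UNIV \<nu>" unfolding \<nu>_def using q0 by (intro continuous_intros contR) auto
    show "0 < c / C" "0 < 2 * pi" using C \<open>c > 0\<close> by auto
    show "c / C \<le> \<nu> \<theta>" for \<theta>
      unfolding \<nu>_def using qpos[of \<theta>] lower[of \<theta>] q(2)[of \<theta>] \<open>c > 0\<close> by (intro frac_le) (auto simp: defs)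
    show "\<nu> (\<theta> + 2 * pi) = \<nu> \<theta>" for \<theta> by (simp add: \<nu>_def defs per)
  qed (rule that)
  have \<nu>0: "\<nu> \<theta> \<noteq> 0" for \<theta> using qpos[of \<theta>] Rpos[of \<theta>] by (simp add: \<nu>_def)
  have chain: "((\<lambda>t. Y (\<psi> t)) has_vector_derivative Y' (\<psi> t)) (at t)"
    if "\<And>\<theta>. (Y has_vector_derivative \<nu> \<theta> *\<^sub>R Y' \<theta>) (at \<theta>)" for Y Y' :: "real \<Rightarrow> real^2" and t
    using vector_diff_chain_at[OF \<psi>(5)[unfolded has_real_derivative_iff_has_vector_derivative] that, of t] \<nu>0
    by (simp add: o_def)
  show ?thesis
  proof (rule that[of "\<lambda>t. X (\<psi> t)"])
    show "solves_ivp U h (fst (u 0) *\<^sub>R er \<sigma> 0) (fst (snd (u 0)) *\<^sub>R er \<sigma> 0 + snd (snd (u 0)) *\<^sub>R et \<sigma> 0) (\<lambda>t. X (\<psi> t))"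
      unfolding solves_ivp_def
    proof (intro conjI exI[of _ "\<lambda>t. V (\<psi> t)"] allI)
      show "X (\<psi> t) \<in> U" for t using U by (simp add: X_def defs)
      show "((\<lambda>t. X (\<psi> t)) has_vector_derivative V (\<psi> t)) (at t)" for t by (rule chain[OF dX])
      show "((\<lambda>t. V (\<psi> t)) has_vector_derivative h (X (\<psi> t))) (at t)" for t
        by (rule chain[OF dV, of t])
    qed (auto simp: \<psi> X_def V_def defs)
    have "X (\<theta> + 2 * pi) = X \<theta>" for \<theta> by (simp add: X_def defs per)
    then show "periodic (\<lambda>t. X (\<psi> t))" unfolding periodic_def using \<psi>(2,3) by auto
    have "range (\<lambda>t. X (\<psi> t)) = X ` range \<psi>" by (simp only: image_image)
    then show "range (\<lambda>t. X (\<psi> t)) = range (\<lambda>\<theta>. fst (u \<theta>) *\<^sub>R er \<sigma> \<theta>)"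
      using \<psi>(4) by (simp add: X_def R_def)
  qed
qed

section \<open>Lipschitz estimates for the polar field\<close>

text \<open>
  Products of Lipschitz functions are Lipschitz only where the factors are bounded, so both properties
  are carried together.  The bounds are uniform in the first argument, which will be the angle.
\<close>
definition bounded_lipschitz ::
  "'a::real_normed_vector set \<Rightarrow> (real \<Rightarrow> 'a \<Rightarrow> 'b::real_normed_vector) \<Rightarrow> bool" where
  "bounded_lipschitz K f \<longleftrightarrow>
     (\<exists>C\<ge>0. \<forall>\<theta>. \<forall>x\<in>K. \<forall>y\<in>K. norm (f \<theta> x - f \<theta> y) \<le> C * norm (x - y)) \<and>
     (\<exists>B\<ge>0. \<forall>\<theta>. \<forall>x\<in>K. norm (f \<theta> x) \<le> B)"

lemma bounded_lipschitzE:
  assumes "bounded_lipschitz K f"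
  obtains C B where "C \<ge> 0" "B \<ge> 0"
    "\<And>\<theta> x y. x \<in> K \<Longrightarrow> y \<in> K \<Longrightarrow> norm (f \<theta> x - f \<theta> y) \<le> C * norm (x - y)"
    "\<And>\<theta> x. x \<in> K \<Longrightarrow> norm (f \<theta> x) \<le> B"
proof -
  from assms obtain C where C: "C \<ge> 0" "\<forall>\<theta>. \<forall>x\<in>K. \<forall>y\<in>K. norm (f \<theta> x - f \<theta> y) \<le> C * norm (x - y)"
    unfolding bounded_lipschitz_def by (elim conjE exE)
  moreover from assms obtain B where B: "B \<ge> 0" "\<forall>\<theta>. \<forall>x\<in>K. norm (f \<theta> x) \<le> B"
    unfolding bounded_lipschitz_def by (elim conjE exE)
  ultimately show ?thesis using that by simp
qed

lemma bounded_lipschitzI: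
  assumes "\<And>\<theta> x y. x \<in> K \<Longrightarrow> y \<in> K \<Longrightarrow> norm (f \<theta> x - f \<theta> y) \<le> C * norm (x - y)"
    "\<And>\<theta> x. x \<in> K \<Longrightarrow> norm (f \<theta> x) \<le> B"
  shows "bounded_lipschitz K f"
  unfolding bounded_lipschitz_def
proof (rule conjI)
  have "norm (f \<theta> x - f \<theta> y) \<le> \<bar>C\<bar> * norm (x - y)" if "x \<in> K" "y \<in> K" for \<theta> x y
    using assms(1)[OF that, of \<theta>] mult_right_mono[OF abs_ge_self[of C] norm_ge_zero[of "x - y"]]
    by linarith
  then show "\<exists>C\<ge>0. \<forall>\<theta>. \<forall>x\<in>K. \<forall>y\<in>K. norm (f \<theta> x - f \<theta> y) \<le> C * norm (x - y)"
    by (intro exI[of _ "\<bar>C\<bar>"]) simp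
  show "\<exists>B\<ge>0. \<forall>\<theta>. \<forall>x\<in>K. norm (f \<theta> x) \<le> B"
  proof (intro exI[of _ "\<bar>B\<bar>"] conjI allI ballI)
    fix \<theta> x assume "x \<in> K"
    then show "norm (f \<theta> x) \<le> \<bar>B\<bar>" using assms(2)[of x \<theta>] by linarith
  qed simp
qed

lemma bounded_lipschitz_const:
  assumes "\<And>\<theta>. norm (f \<theta>) \<le> B"
  shows "bounded_lipschitz K (\<lambda>\<theta> x. f \<theta>)"
  by (rule bounded_lipschitzI[of _ _ 0 B]) (auto simp: assms)

lemma bounded_lipschitz_linear:
  assumes "bounded_linear f" "bounded K"
  shows "bounded_lipschitz K (\<lambda>\<theta>. f)"
proof -
  interpret f: bounded_linear f by fact
  obtain C where C: "\<And>x. norm (f x) \<le> norm x * C" using f.bounded by blast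
  obtain B where B: "\<And>x. x \<in> f ` K \<Longrightarrow> norm x \<le> B"
    using bounded_linear_image[OF assms(2,1)] by (auto simp: bounded_iff)
  show ?thesis
  proof (rule bounded_lipschitzI[of _ _ C B])
    show "norm (f x - f y) \<le> C * norm (x - y)" for x y
      using C[of "x - y"] by (simp add: f.diff mult.commute)
    show "norm (f x) \<le> B" if "x \<in> K" for x using B that by blast
  qed
qed

lemma bounded_lipschitz_add:
  assumes "bounded_lipschitz K f" "bounded_lipschitz K g"
  shows "bounded_lipschitz K (\<lambda>\<theta> x. f \<theta> x + g \<theta> x)"
proof -
  obtain C B where f: "\<And>\<theta> x y. x \<in> K \<Longrightarrow> y \<in> K \<Longrightarrow> norm (f \<theta> x - f \<theta> y) \<le> C * norm (x - y)"
    "\<And>\<theta> x. x \<in> K \<Longrightarrow> norm (f \<theta> x) \<le> B" by (rule bounded_lipschitzE[OF assms(1)]) blast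
  obtain C' B' where g: "\<And>\<theta> x y. x \<in> K \<Longrightarrow> y \<in> K \<Longrightarrow> norm (g \<theta> x - g \<theta> y) \<le> C' * norm (x - y)"
    "\<And>\<theta> x. x \<in> K \<Longrightarrow> norm (g \<theta> x) \<le> B'" by (rule bounded_lipschitzE[OF assms(2)]) blast
  show ?thesis
  proof (rule bounded_lipschitzI[of _ _ "C + C'" "B + B'"])
    fix \<theta> x y assume xy: "x \<in> K" "y \<in> K"
    show "norm (f \<theta> x + g \<theta> x - (f \<theta> y + g \<theta> y)) \<le> (C + C') * norm (x - y)"
      using norm_diff_triangle_ineq[of "f \<theta> x" "g \<theta> x" "f \<theta> y" "g \<theta> y"] f(1)[OF xy, of \<theta>] g(1)[OF xy, of \<theta>]
      by (simp add: distrib_right)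
  next
    fix \<theta> x assume "x \<in> K"
    then show "norm (f \<theta> x + g \<theta> x) \<le> B + B'" by (intro norm_triangle_le add_mono f g)
  qed
qed

lemma bounded_lipschitz_bilinear:
  assumes "bounded_bilinear m" "bounded_lipschitz K f" "bounded_lipschitz K g"
  shows "bounded_lipschitz K (\<lambda>\<theta> x. m (f \<theta> x) (g \<theta> x))"
proof -
  interpret m: bounded_bilinear m by fact
  obtain N where N: "N \<ge> 0" "\<And>a b. norm (m a b) \<le> norm a * norm b * N"
    using m.nonneg_bounded by blast
  obtain C B where f: "C \<ge> 0" "B \<ge> 0" "\<And>\<theta> x y. x \<in> K \<Longrightarrow> y \<in> K \<Longrightarrow> norm (f \<theta> x - f \<theta> y) \<le> C * norm (x - y)"
    "\<And>\<theta> x. x \<in> K \<Longrightarrow> norm (f \<theta> x) \<le> B" by (rule bounded_lipschitzE[OF assms(2)]) blast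
  obtain C' B' where g: "C' \<ge> 0" "B' \<ge> 0" "\<And>\<theta> x y. x \<in> K \<Longrightarrow> y \<in> K \<Longrightarrow> norm (g \<theta> x - g \<theta> y) \<le> C' * norm (x - y)"
    "\<And>\<theta> x. x \<in> K \<Longrightarrow> norm (g \<theta> x) \<le> B'" by (rule bounded_lipschitzE[OF assms(3)]) blast
  show ?thesis
  proof (rule bounded_lipschitzI[of _ _ "(C * B' + B * C') * N" "B * B' * N"])
    fix \<theta> x y assume xy: "x \<in> K" "y \<in> K"
    have "m (f \<theta> x) (g \<theta> x) - m (f \<theta> y) (g \<theta> y) = m (f \<theta> x - f \<theta> y) (g \<theta> x) + m (f \<theta> y) (g \<theta> x - g \<theta> y)"
      by (simp add: m.diff_left m.diff_right)
    also have "norm \<dots> \<le> norm (f \<theta> x - f \<theta> y) * norm (g \<theta> x) * N + norm (f \<theta> y) * norm (g \<theta> x - g \<theta> y) * N"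
      by (intro norm_triangle_le add_mono N)
    also have "\<dots> \<le> (C * norm (x - y)) * B' * N + B * (C' * norm (x - y)) * N"
      by (intro add_mono mult_mono f g xy N order_refl mult_nonneg_nonneg norm_ge_zero)
    finally show "norm (m (f \<theta> x) (g \<theta> x) - m (f \<theta> y) (g \<theta> y)) \<le> (C * B' + B * C') * N * norm (x - y)"
      by (simp add: algebra_simps)
  next
    fix \<theta> x assume x: "x \<in> K"
    show "norm (m (f \<theta> x) (g \<theta> x)) \<le> B * B' * N"
      by (rule order_trans[OF N(2)]) (intro mult_mono f g x N order_refl mult_nonneg_nonneg norm_ge_zero)
  qed
qed

lemma bounded_lipschitz_compose:
  assumes f: "bounded_lipschitz K f" and h: "L-lipschitz_on A h" "bounded (h ` A)"
    and "\<And>\<theta> x. x \<in> K \<Longrightarrow> f \<theta> x \<in> A"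
  shows "bounded_lipschitz K (\<lambda>\<theta> x. h (f \<theta> x))"
proof -
  obtain C where f': "\<And>\<theta> x y. x \<in> K \<Longrightarrow> y \<in> K \<Longrightarrow> norm (f \<theta> x - f \<theta> y) \<le> C * norm (x - y)"
    by (rule bounded_lipschitzE[OF f]) blast
  obtain B where B: "\<And>x. x \<in> A \<Longrightarrow> norm (h x) \<le> B" using h(2) by (auto simp: bounded_iff)
  show ?thesis
  proof (rule bounded_lipschitzI[of _ _ "L * C" B])
    fix \<theta> x y assume xy: "x \<in> K" "y \<in> K"
    have "norm (h (f \<theta> x) - h (f \<theta> y)) \<le> L * norm (f \<theta> x - f \<theta> y)"
      using lipschitz_on_normD[OF h(1)] assms(4) xy by blast
    also have "\<dots> \<le> L * (C * norm (x - y))"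
      by (intro mult_left_mono f' xy lipschitz_on_nonneg[OF h(1)])
    finally show "norm (h (f \<theta> x) - h (f \<theta> y)) \<le> L * C * norm (x - y)" by simp
  qed (use B assms(4) in blast)
qed

lemma bounded_lipschitz_Pair:
  assumes "bounded_lipschitz K f" "bounded_lipschitz K g"
  shows "bounded_lipschitz K (\<lambda>\<theta> x. (f \<theta> x, g \<theta> x))"
proof -
  have l: "bounded_lipschitz K (\<lambda>\<theta> x. l (k \<theta> x))"
    if l: "\<And>x. norm (l x) \<le> norm x" "\<And>x y. l x - l y = l (x - y)" and "bounded_lipschitz K k"
    for l :: "'c \<Rightarrow> 'b \<times> 'c" and k :: "real \<Rightarrow> 'a \<Rightarrow> 'c"
    using that(3) unfolding bounded_lipschitz_def l(2) by (meson l(1) order_trans)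
  have l': "bounded_lipschitz K (\<lambda>\<theta> x. l (k \<theta> x))"
    if l: "\<And>x. norm (l x) \<le> norm x" "\<And>x y. l x - l y = l (x - y)" and "bounded_lipschitz K k"
    for l :: "'b \<Rightarrow> 'b \<times> 'c" and k :: "real \<Rightarrow> 'a \<Rightarrow> 'b"
    using that(3) unfolding bounded_lipschitz_def l(2) by (meson l(1) order_trans)
  show ?thesis
    using bounded_lipschitz_add[OF l'[of "\<lambda>x. (x, 0)", OF _ _ assms(1)] l[of "\<lambda>x. (0, x)", OF _ _ assms(2)]]
    by simp
qed

lemma bounded_lipschitz_inverse:
  fixes f :: "real \<Rightarrow> 'a::real_normed_vector \<Rightarrow> real"
  assumes f: "bounded_lipschitz K f" and "c > 0" and lower: "\<And>\<theta> x. x \<in> K \<Longrightarrow> c \<le> f \<theta> x"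
  shows "bounded_lipschitz K (\<lambda>\<theta> x. inverse (f \<theta> x))"
proof -
  obtain C where C: "C \<ge> 0" "\<And>\<theta> x y. x \<in> K \<Longrightarrow> y \<in> K \<Longrightarrow> norm (f \<theta> x - f \<theta> y) \<le> C * norm (x - y)"
    by (rule bounded_lipschitzE[OF f]) blast
  have inv: "0 < inverse (f \<theta> x)" "inverse (f \<theta> x) \<le> inverse c" "f \<theta> x \<noteq> 0" if "x \<in> K" for \<theta> x
    using lower[OF that, of \<theta>] \<open>c > 0\<close> by (auto intro: le_imp_inverse_le)
  show ?thesis
  proof (rule bounded_lipschitzI[of _ _ "inverse c * C * inverse c" "inverse c"])
    fix \<theta> x y assume xy: "x \<in> K" "y \<in> K"
    have "norm (inverse (f \<theta> x) - inverse (f \<theta> y)) =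
        inverse (f \<theta> x) * norm (f \<theta> x - f \<theta> y) * inverse (f \<theta> y)"
      using inv(1,3)[OF xy(1), of \<theta>] inv(1,3)[OF xy(2), of \<theta>]
      by (simp add: inverse_diff_inverse abs_mult)
    also have "\<dots> \<le> inverse c * (C * norm (x - y)) * inverse c"
      using inv(1,2)[OF xy(1), of \<theta>] inv(1,2)[OF xy(2), of \<theta>] \<open>c > 0\<close> C(1)
      by (intro mult_mono C(2) xy) auto
    finally show "norm (inverse (f \<theta> x) - inverse (f \<theta> y)) \<le> inverse c * C * inverse c * norm (x - y)"
      by (simp add: algebra_simps)
  qed (use inv in \<open>fastforce simp: less_imp_le\<close>)
qed

lemma bounded_lipschitz_polar_field:
  fixes K :: "(real \<times> real \<times> real) set"
  assumes \<sigma>: "\<bar>\<sigma>\<bar> = 1" and h: "L-lipschitz_on A h" and "compact A"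
    and A: "\<And>\<theta> u. u \<in> K \<Longrightarrow> fst u *\<^sub>R er \<sigma> \<theta> \<in> A"
    and K: "bounded K" "c > 0" "\<And>u. u \<in> K \<Longrightarrow> c \<le> snd (snd u)"
  shows "bounded_lipschitz K (polar_field h \<sigma>)"
proof -
  have "bounded (h ` A)"
    using compact_continuous_image[OF lipschitz_on_continuous_on[OF h] \<open>compact A\<close>] compact_imp_bounded by blast
  note bl = bounded_lipschitz_const[of _ 1] bounded_lipschitz_linear[OF _ K(1)] bounded_lipschitz_add
    bounded_lipschitz_bilinear[OF bounded_bilinear_mult] bounded_lipschitz_bilinear[OF bounded_bilinear_inner]
    bounded_lipschitz_bilinear[OF bounded_bilinear_scaleR]
    bounded_lipschitz_compose[OF _ h this A] bounded_lipschitz_Pair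
    bounded_lipschitz_inverse[OF _ K(2,3)]
  have lin: "bounded_linear (\<lambda>u::real \<times> real \<times> real. fst u)" "bounded_linear (\<lambda>u::real \<times> real \<times> real. fst (snd u))"
    "bounded_linear (\<lambda>u::real \<times> real \<times> real. snd (snd u))"
    by (intro bounded_linear_intros)+
  note lin = lin bounded_linear_minus[OF lin(2)]
  have frame: "norm (er \<sigma> \<theta>) \<le> 1" "norm (et \<sigma> \<theta>) \<le> 1" for \<theta> using \<sigma> by simp_all
  have eq: "polar_field h \<sigma> = (\<lambda>\<theta> u. (fst (snd u) * (fst u * inverse (snd (snd u))),
      snd (snd u) + fst u * inverse (snd (snd u)) * (h (fst u *\<^sub>R er \<sigma> \<theta>) \<bullet> er \<sigma> \<theta>),
      - fst (snd u) + fst u * inverse (snd (snd u)) * (h (fst u *\<^sub>R er \<sigma> \<theta>) \<bullet> et \<sigma> \<theta>)))"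
    by (auto simp: polar_field_def divide_inverse fun_eq_iff)
  show ?thesis unfolding eq by (intro bl lin frame)
qed

lemma continuous_polar_field:
  assumes h: "continuous_on A h" and A: "\<And>\<theta> u. u \<in> K \<Longrightarrow> fst u *\<^sub>R er \<sigma> \<theta> \<in> A"
    and q: "\<And>u. u \<in> K \<Longrightarrow> snd (snd u) \<noteq> 0"
  shows "continuous_on (UNIV \<times> K) (\<lambda>(\<theta>, u). polar_field h \<sigma> \<theta> u)"
proof -
  have eq: "(\<lambda>(\<theta>, u). polar_field h \<sigma> \<theta> u) = (\<lambda>z. let \<theta> = fst z; u = snd z in (fst (snd u) * (fst u / snd (snd u)),
      snd (snd u) + fst u / snd (snd u) * (h (fst u *\<^sub>R er \<sigma> \<theta>) \<bullet> er \<sigma> \<theta>),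
      - fst (snd u) + fst u / snd (snd u) * (h (fst u *\<^sub>R er \<sigma> \<theta>) \<bullet> et \<sigma> \<theta>)))"
    by (auto simp: polar_field_def fun_eq_iff)
  have "continuous_on (UNIV \<times> K) (\<lambda>z. h (fst (snd z) *\<^sub>R er \<sigma> (fst z)))"
    by (rule continuous_on_compose2[OF h]) (use A in \<open>auto intro!: continuous_intros\<close>)
  then show ?thesis
    unfolding eq Let_def by (intro continuous_intros) (use q in auto)
qed

lemma C1_on_lipschitz_on_compact:
  assumes "C1_on h U" "open U" "compact A" "A \<subseteq> U"
  obtains L where "L-lipschitz_on A h"
proof -
  obtain f' :: "real^2 \<Rightarrow> (real^2) \<Rightarrow>\<^sub>L (real^2)" where
    f': "\<And>r. r \<in> U \<Longrightarrow> (h has_derivative blinfun_apply (f' r)) (at r)" "continuous_on U f'"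
    using assms(1) unfolding C1_on_def by blast
  have "local_lipschitz UNIV U (\<lambda>_::real. h)"
  proof (rule c1_implies_local_lipschitz[where f' = "\<lambda>(t, x). f' x"])
    show "continuous_on (UNIV \<times> U) (\<lambda>(t::real, x). f' x)"
      unfolding split_beta by (intro continuous_on_compose2[OF f'(2)] continuous_intros) auto
  qed (use f' assms in auto)
  then have "local_lipschitz {0} A (\<lambda>_::real. h)"
    by (rule local_lipschitz_subset) (use assms in auto)
  then obtain L where "\<And>t::real. t \<in> {0} \<Longrightarrow> L-lipschitz_on A h"
    by (rule local_lipschitz_compact_implies_lipschitz[of "{0}" A]) (use assms in auto)
  then show ?thesis using that by blast
qed

section \<open>The linearization at the circular orbit\<close>

text \<open>
  The functions \<open>S\<close> and \<open>C\<close> are trigonometric, affine or hyperbolic, according to the sign of \<open>\<beta>\<close>.  Only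
  the first case can be resonant, \<open>S pi = 0\<close>, and then \<open>sqrt \<beta>\<close> is a positive integer; \<open>\<beta> \<le> 2\<close> leaves
  only \<open>\<beta> = 1\<close>.
\<close>
lemma oscillator_solution:
  fixes \<beta> :: real
  assumes "\<beta> \<le> 2" "\<beta> \<noteq> 1"
  obtains S C :: "real \<Rightarrow> real"
  where "S 0 = 0" "C 0 = 1" "\<And>t. (S has_real_derivative C t) (at t)"
    "\<And>t. (C has_real_derivative - \<beta> * S t) (at t)" "S pi \<noteq> 0"
proof -
  consider "\<beta> > 0" | "\<beta> = 0" | "\<beta> < 0" by linarith
  then show ?thesis
  proof cases
    case 1
    define w where "w = sqrt \<beta>"
    have w: "w > 0" "w * w = \<beta>" using 1 by (auto simp: w_def)
    show ?thesis
    proof (rule that[of "\<lambda>t. sin (w * t) / w" "\<lambda>t. cos (w * t)"])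
      show "((\<lambda>t. sin (w * t) / w) has_real_derivative cos (w * t)) (at t)" for t
        using w by (auto intro!: derivative_eq_intros)
      show "((\<lambda>t. cos (w * t)) has_real_derivative - \<beta> * (sin (w * t) / w)) (at t)" for t
        using w(1) by (auto intro!: derivative_eq_intros simp flip: w(2))
      show "sin (w * pi) / w \<noteq> 0"
      proof
        assume "sin (w * pi) / w = 0"
        then obtain i :: int where "w * pi = i * pi" using w(1) by (auto simp: sin_zero_iff_int2)
        then have i: "w = i" by simp
        have "w < 2"
        proof (rule ccontr)
          assume "\<not> w < 2"
          then have "2 * 2 \<le> w * w" by (intro mult_mono) auto
          then show False using assms w by simp
        qed
        then have "i = 1" using w(1) i by simp
        then show False using i w(2) assms by simp
      qed
    qed auto
  next
    case 2
    show ?thesis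
      by (rule that[of "\<lambda>t. t" "\<lambda>t. 1"]) (use 2 in \<open>auto intro!: derivative_eq_intros\<close>)
  next
    case 3
    define w where "w = sqrt (- \<beta>)"
    have w: "w > 0" "w * w = - \<beta>" using 3 by (auto simp: w_def)
    show ?thesis
    proof (rule that[of "\<lambda>t. sinh (w * t) / w" "\<lambda>t. cosh (w * t)"])
      show "((\<lambda>t. sinh (w * t) / w) has_real_derivative cosh (w * t)) (at t)" for t
        using w(1) by (auto intro!: derivative_eq_intros)
      show "((\<lambda>t. cosh (w * t)) has_real_derivative - \<beta> * (sinh (w * t) / w)) (at t)" for t
        using w(1) by (auto intro!: derivative_eq_intros simp flip: w(2))
      show "sinh (w * pi) / w \<noteq> 0" using w(1) by simp
    qed auto
  qed
qed

text \<open>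
  A small change \<open>s e\<close> of the initial value at the equilibrium \<open>uc\<close> and a small perturbation \<open>H\<close> of the
  field \<open>F0\<close> move the endpoint.  If \<open>\<phi>\<close> solves the adjoint of the linearized equation, then the
  derivative of \<open>\<phi> t \<bullet> (u t - uc)\<close> contains only the nonlinear remainder and the perturbation, so this
  quantity stays close to its initial value \<open>s (\<phi> 0 \<bullet> e)\<close>.  The error is controlled by the differentiability of \<open>F0\<close> at
  \<open>uc\<close> and by the uniform distance between \<open>H\<close> and \<open>F0\<close>.  Evaluating \<open>H\<close> at the closest point of
  the ball allows fields that are meaningful only near the equilibrium; the conclusion that \<open>u\<close> stays
  in the ball shows that the truncation has no effect.
\<close>
lemma adjoint_endpoint_estimate:
  fixes F0 :: "'a::euclidean_space \<Rightarrow> 'a" and \<phi> \<phi>' :: "real \<Rightarrow> 'a"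
  assumes der: "(F0 has_derivative A) (at uc)" and "F0 uc = 0"
    and \<phi>: "\<And>t. (\<phi> has_vector_derivative \<phi>' t) (at t)"
    and adj: "\<And>t w. \<phi>' t \<bullet> w + \<phi> t \<bullet> A w = 0"
    and e: "norm e = 1" "\<phi> 0 \<bullet> e \<noteq> 0" and "T > 0" "\<eta> > 0" "d > 0"
  obtains r \<delta> \<epsilon> where "0 < r" "r \<le> d" "0 < \<delta>" "\<delta> < \<eta>" "0 < \<epsilon>"
    "\<And>H u s. (\<And>t w. t \<in> {0..T} \<Longrightarrow> w \<in> cball uc r \<Longrightarrow> norm (H t w - F0 w) \<le> \<epsilon>) \<Longrightarrow>
      (\<And>t. t \<in> {0..T} \<Longrightarrow> (u has_vector_derivative H t (closest_point (cball uc r) (u t))) (at t)) \<Longrightarrow>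
      u 0 = uc + s *\<^sub>R e \<Longrightarrow> \<bar>s\<bar> \<le> \<delta> \<Longrightarrow>
      (\<forall>t\<in>{0..T}. u t \<in> cball uc r) \<and>
      \<bar>\<phi> T \<bullet> (u T - uc) - s * (\<phi> 0 \<bullet> e)\<bar> \<le> \<bar>\<phi> 0 \<bullet> e\<bar> * \<delta> / 2"
proof -
  define c0 where "c0 = \<bar>\<phi> 0 \<bullet> e\<bar>"
  have c0: "c0 > 0" using e by (simp add: c0_def)
  interpret A: bounded_linear A using der by (rule has_derivative_bounded_linear)
  obtain N where N: "N \<ge> 0" "\<And>w. norm (A w) \<le> norm w * N" using A.nonneg_bounded by blast
  define L where "L = N + 1"
  have L: "L \<ge> 0" using N by (simp add: L_def)
  define E where "E = sqrt (2 * exp ((2 * L + 1) * T))"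
  have E: "E > 0" by (simp add: E_def)
  obtain M where M: "M > 0" "\<And>t. t \<in> {0..T} \<Longrightarrow> norm (\<phi> t) \<le> M"
  proof -
    have "continuous_on {0..T} \<phi>"
      using \<phi> has_vector_derivative_continuous by (blast intro: continuous_at_imp_continuous_on)
    then have "bounded (\<phi> ` {0..T})" using compact_continuous_image compact_imp_bounded by blast
    then show ?thesis using that by (auto simp: bounded_pos)
  qed
  \<comment> \<open>\<open>E\<close> bounds the growth of an initial error up to time \<open>T\<close>.  The constants \<open>\<gamma>\<close> (nonlinear remainder)
    and \<open>\<epsilon>\<close> (perturbation) are such that each source of error contributes at most \<open>c0 \<delta> / 4\<close>.\<close>
  define \<gamma> where "\<gamma> = min 1 (c0 / (4 * T * M * E))"
  have \<gamma>: "0 < \<gamma>" "\<gamma> \<le> 1" "T * M * (\<gamma> * E) \<le> c0 / 4"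
  proof -
    have "\<gamma> \<le> c0 / (4 * T * M * E)" by (simp add: \<gamma>_def)
    then show "T * M * (\<gamma> * E) \<le> c0 / 4"
      using M(1) E \<open>T > 0\<close> by (simp add: field_simps)
  qed (use c0 M(1) E \<open>T > 0\<close> in \<open>auto simp: \<gamma>_def\<close>)
  obtain r0 where r0: "r0 > 0" "\<And>w. norm (w - uc) < r0 \<Longrightarrow> norm (F0 w - A (w - uc)) \<le> \<gamma> * norm (w - uc)"
    using der \<gamma>(1) \<open>F0 uc = 0\<close> unfolding has_derivative_at_alt by auto
  define r where "r = min d (r0 / 2)"
  have r: "0 < r" "r \<le> d" "r < r0" using r0(1) \<open>d > 0\<close> by (auto simp: r_def)
  define \<delta> where "\<delta> = min (\<eta> / 2) (r / E)"
  have \<delta>: "0 < \<delta>" "\<delta> < \<eta>" "E * \<delta> \<le> r"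
  proof -
    have "\<delta> \<le> r / E" by (simp add: \<delta>_def)
    then show "E * \<delta> \<le> r" using E by (simp add: field_simps)
  qed (use r(1) E \<open>\<eta> > 0\<close> in \<open>auto simp: \<delta>_def\<close>)
  define \<epsilon> where "\<epsilon> = min \<delta> (c0 * \<delta> / (4 * T * M))"
  have \<epsilon>: "0 < \<epsilon>" "\<epsilon> \<le> \<delta>" "T * M * \<epsilon> \<le> c0 * \<delta> / 4"
  proof -
    have "\<epsilon> \<le> c0 * \<delta> / (4 * T * M)" by (simp add: \<epsilon>_def)
    then show "T * M * \<epsilon> \<le> c0 * \<delta> / 4"
      using M(1) \<open>T > 0\<close> by (simp add: field_simps)
  qed (use c0 M(1) \<delta> \<open>T > 0\<close> in \<open>auto simp: \<epsilon>_def\<close>)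
  show ?thesis
  proof (rule that[OF r(1,2) \<delta>(1,2) \<epsilon>(1)])
    fix H u s
    let ?K = "cball uc r"
    assume H: "\<And>t w. t \<in> {0..T} \<Longrightarrow> w \<in> ?K \<Longrightarrow> norm (H t w - F0 w) \<le> \<epsilon>"
      and u: "\<And>t. t \<in> {0..T} \<Longrightarrow> (u has_vector_derivative H t (closest_point ?K (u t))) (at t)"
      and u0: "u 0 = uc + s *\<^sub>R e" and s: "\<bar>s\<bar> \<le> \<delta>"
    have close: "norm (H t w - A (w - uc)) \<le> \<gamma> * norm (w - uc) + \<epsilon>" if "t \<in> {0..T}" "w \<in> ?K" for t w
    proof -
      have "norm (w - uc) < r0" using that r(3) by (simp add: dist_norm norm_minus_commute)
      then show ?thesis
        using norm_triangle_mono[OF H[OF that] r0(2)[of w]] by (simp add: add.commute)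
    qed
    define z where "z = (\<lambda>t. u t - uc)"
    define z' where "z' = (\<lambda>t. H t (closest_point ?K (u t)))"
    have z: "(z has_vector_derivative z' t) (at t)" if "t \<in> {0..T}" for t
      using u[OF that] by (auto simp: z_def z'_def intro!: derivative_eq_intros)
    have ne: "?K \<noteq> {}" "closed ?K" "convex ?K" using r(1) by auto
    have growth: "norm (z' t) \<le> L * norm (z t) + \<epsilon>" if t: "t \<in> {0..T}" for t
    proof -
      let ?w = "closest_point ?K (u t)"
      have w: "?w \<in> ?K" using ne by (intro closest_point_in_set)
      have "norm (?w - uc) \<le> norm (z t)"
        using closest_point_lipschitz[OF ne(3,2,1), of "u t" uc] closest_point_self[of uc ?K] r(1)
        by (simp add: dist_norm z_def)
      moreover have "norm (z' t) \<le> L * norm (?w - uc) + \<epsilon>"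
      proof -
        have "norm (z' t) \<le> norm (A (?w - uc)) + norm (z' t - A (?w - uc))"
          by (simp add: norm_triangle_sub)
        also have "\<dots> \<le> norm (?w - uc) * N + (\<gamma> * norm (?w - uc) + \<epsilon>)"
          using close[OF t w] unfolding z'_def by (intro add_mono N)
        also have "\<dots> \<le> norm (?w - uc) * N + (1 * norm (?w - uc) + \<epsilon>)"
          using \<gamma>(2) by (intro add_left_mono add_right_mono mult_right_mono) auto
        finally show ?thesis by (simp add: L_def algebra_simps)
      qed
      ultimately show ?thesis using mult_left_mono[of _ _ L] L by fastforce
    qed
    have small: "norm (z t) \<le> E * \<delta>" if t: "t \<in> {0..T}" for t
    proof (rule power2_le_imp_le)
      have "(norm (z t))\<^sup>2 \<le> exp ((2 * L + 1) * t) * ((norm (z 0))\<^sup>2 + \<epsilon>\<^sup>2)"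
        by (rule norm_growth[OF z growth L t])
      also have "\<dots> \<le> exp ((2 * L + 1) * T) * (\<delta>\<^sup>2 + \<delta>\<^sup>2)"
      proof (intro mult_mono add_mono power_mono)
        show "norm (z 0) \<le> \<delta>" using s e(1) by (simp add: z_def u0)
      qed (use t L \<epsilon> in auto)
      also have "\<dots> = (E * \<delta>)\<^sup>2" by (simp add: E_def power_mult_distrib)
      finally show "(norm (z t))\<^sup>2 \<le> (E * \<delta>)\<^sup>2" .
    qed (use E \<delta> in simp)
    have inK: "u t \<in> ?K" if "t \<in> {0..T}" for t
      using small[OF that] \<delta>(3) by (simp add: z_def dist_norm norm_minus_commute)
    define D where "D = M * (\<gamma> * (E * \<delta>) + \<epsilon>)"
    have dG: "((\<lambda>t. \<phi> t \<bullet> z t) has_vector_derivative \<phi> t \<bullet> (z' t - A (z t))) (at t)" if "t \<in> {0..T}" for t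
    proof -
      have "((\<lambda>t. \<phi> t \<bullet> z t) has_derivative (\<lambda>h. \<phi> t \<bullet> (h *\<^sub>R z' t) + (h *\<^sub>R \<phi>' t) \<bullet> z t)) (at t)"
        using \<phi>[of t] z[OF that] unfolding has_vector_derivative_def by (rule has_derivative_inner)
      moreover have "(\<lambda>h. \<phi> t \<bullet> (h *\<^sub>R z' t) + (h *\<^sub>R \<phi>' t) \<bullet> z t) = (\<lambda>h. h *\<^sub>R (\<phi> t \<bullet> (z' t - A (z t))))"
      proof
        fix h
        have "\<phi>' t \<bullet> z t = - (\<phi> t \<bullet> A (z t))" using adj[of t "z t"] by linarith
        then show "\<phi> t \<bullet> (h *\<^sub>R z' t) + (h *\<^sub>R \<phi>' t) \<bullet> z t = h *\<^sub>R (\<phi> t \<bullet> (z' t - A (z t)))"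
          by (simp add: inner_diff_right algebra_simps)
      qed
      ultimately show ?thesis unfolding has_vector_derivative_def by simp
    qed
    have "norm (\<phi> T \<bullet> z T - \<phi> 0 \<bullet> z 0) \<le> D * T - D * 0"
    proof (rule differentiable_bound_general[where f' = "\<lambda>t. \<phi> t \<bullet> (z' t - A (z t))" and \<phi>' = "\<lambda>t. D"])
      show "continuous_on {0..T} (\<lambda>t. \<phi> t \<bullet> z t)"
        using dG has_vector_derivative_continuous continuous_at_imp_continuous_on by blast
      show "((*) D has_vector_derivative D) (at t)" for t
        unfolding has_real_derivative_iff_has_vector_derivative[symmetric]
        by (auto intro!: derivative_eq_intros)
      fix t assume "0 < t" "t < T"
      then have t: "t \<in> {0..T}" by simp
      show "((\<lambda>t. \<phi> t \<bullet> z t) has_vector_derivative \<phi> t \<bullet> (z' t - A (z t))) (at t)" by (rule dG[OF t])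
      have "norm (z' t - A (z t)) \<le> \<gamma> * norm (z t) + \<epsilon>"
        using close[OF t inK[OF t]] closest_point_self[OF inK[OF t]] by (simp add: z'_def z_def)
      also have "\<dots> \<le> \<gamma> * (E * \<delta>) + \<epsilon>" using small[OF t] \<gamma>(1) by simp
      finally have "norm (\<phi> t) * norm (z' t - A (z t)) \<le> D"
        unfolding D_def by (intro mult_mono M t) (use M(1) in auto)
      then show "norm (\<phi> t \<bullet> (z' t - A (z t))) \<le> D"
        using Cauchy_Schwarz_ineq2[of "\<phi> t" "z' t - A (z t)"] by simp
    qed (use \<open>T > 0\<close> in \<open>auto intro!: continuous_intros\<close>)
    also have "D * T - D * 0 \<le> c0 * \<delta> / 2"
    proof -
      have "D * T = (T * M * (\<gamma> * E)) * \<delta> + T * M * \<epsilon>" by (simp add: D_def algebra_simps)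
      also have "\<dots> \<le> c0 / 4 * \<delta> + c0 * \<delta> / 4"
        using \<gamma>(3) \<epsilon>(3) \<delta>(1) by (intro add_mono mult_right_mono) auto
      finally show ?thesis by (simp add: mult.commute)
    qed
    finally have "\<bar>\<phi> T \<bullet> (u T - uc) - s * (\<phi> 0 \<bullet> e)\<bar> \<le> \<bar>\<phi> 0 \<bullet> e\<bar> * \<delta> / 2"
      by (simp add: z_def u0 c0_def)
    then show "(\<forall>t\<in>{0..T}. u t \<in> ?K) \<and>
      \<bar>\<phi> T \<bullet> (u T - uc) - s * (\<phi> 0 \<bullet> e)\<bar> \<le> \<bar>\<phi> 0 \<bullet> e\<bar> * \<delta> / 2"
      using inK by blast
  qed
qed

section \<open>Shooting for a symmetric orbit\<close>

lemma linear_flip_p: "bounded_linear flip_p"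
proof -
  have "flip_p = (\<lambda>u. (fst u, - fst (snd u), snd (snd u)))" by (auto simp: flip_p_def)
  moreover have "bounded_linear (\<lambda>u::real \<times> real \<times> real. (fst u, - fst (snd u), snd (snd u)))"
    by (intro bounded_linear_Pair bounded_linear_minus bounded_linear_compose[OF bounded_linear_fst]
        bounded_linear_compose[OF bounded_linear_snd] bounded_linear_fst bounded_linear_snd bounded_linear_ident)
  ultimately show ?thesis by simp
qed

lemma dist_flip_p: "dist (flip_p u) (flip_p v) = dist u v"
proof -
  have "\<bar>y - x\<bar> = \<bar>x - y\<bar>" for x y :: real by (rule abs_minus_commute)
  then show ?thesis
    by (cases u, cases v) (simp add: flip_p_def dist_Pair_Pair dist_real_def)
qed

lemma flip_p_flip_p: "flip_p (flip_p u) = u"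
  by (simp add: flip_p_def split: prod.split)

text \<open>
  The hypothesis \<open>endpoint\<close> says that the radial velocity after half a turn is \<open>s k\<close> up to an
  error smaller than \<open>\<bar>k\<bar> \<delta>\<close>; hence it has opposite signs for \<open>s = - \<delta>\<close> and \<open>s = \<delta>\<close>, and it is zero for
  some \<open>s\<close> in between.  The states of this orbit at the angles \<open>0\<close> and \<open>pi\<close> are fixed by \<open>flip_p\<close>, so
  reversibility makes it periodic.
\<close>
lemma periodic_polar_orbit:
  fixes \<rho> q0 \<sigma> r :: real and h :: "real^2 \<Rightarrow> real^2"
  defines "uc \<equiv> (\<rho>, 0, q0)"
  assumes \<sigma>: "\<bar>\<sigma>\<bar> = 1" and h: "L-lipschitz_on A h" and A: "compact A" "A \<subseteq> U"
    and sym: "\<And>x. x \<in> U \<Longrightarrow> h (reflect_x x) = reflect_x (h x)"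
    and "r > 0" and K: "\<And>u \<theta>. u \<in> cball uc r \<Longrightarrow> fst u *\<^sub>R er \<sigma> \<theta> \<in> A"
    and c: "c > 0" "\<And>u. u \<in> cball uc r \<Longrightarrow> c \<le> snd (snd u)"
    and "\<delta> > 0" "k \<noteq> 0"
    and endpoint: "\<And>u s. (\<And>t. t \<in> {0..pi} \<Longrightarrow>
        (u has_vector_derivative polar_field h \<sigma> t (closest_point (cball uc r) (u t))) (at t)) \<Longrightarrow>
      u 0 = uc + s *\<^sub>R (0, 0, 1) \<Longrightarrow> \<bar>s\<bar> \<le> \<delta> \<Longrightarrow>
      (\<forall>t\<in>{0..pi}. u t \<in> cball uc r) \<and> \<bar>fst (snd (u pi)) - s * k\<bar> \<le> \<bar>k\<bar> * \<delta> / 2"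
  obtains s u where "\<bar>s\<bar> \<le> \<delta>" "u 0 = (\<rho>, 0, q0 + s)"
    "\<And>t. (u has_vector_derivative polar_field h \<sigma> t (u t)) (at t)" "\<And>t. u t \<in> cball uc r"
    "\<And>t. u (t + 2 * pi) = u t" "\<And>t. u (- t) = flip_p (u t)"
proof -
  let ?K = "cball uc r" and ?e = "(0, 0, 1) :: real \<times> real \<times> real"
  \<comment> \<open>truncation makes the field globally Lipschitz and bounded, and preserves reversibility because
    \<open>flip_p\<close> is an isometry that maps the ball to itself\<close>
  define G where "G = (\<lambda>t x. polar_field h \<sigma> t (closest_point ?K x))"
  have ne: "?K \<noteq> {}" "closed ?K" "convex ?K" "bounded ?K" using \<open>r > 0\<close> by auto
  have cp: "closest_point ?K x \<in> ?K" for x using ne by (intro closest_point_in_set)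
  obtain C B where C: "C \<ge> 0"
    "\<And>t x y. x \<in> ?K \<Longrightarrow> y \<in> ?K \<Longrightarrow> norm (polar_field h \<sigma> t x - polar_field h \<sigma> t y) \<le> C * norm (x - y)"
    "\<And>t x. x \<in> ?K \<Longrightarrow> norm (polar_field h \<sigma> t x) \<le> B"
    by (rule bounded_lipschitzE[OF bounded_lipschitz_polar_field[OF \<sigma> h A(1) K ne(4) c]]) (assumption, assumption, rule that)
  have lip: "norm (G t x - G t y) \<le> C * norm (x - y)" for t x y
  proof -
    have "norm (G t x - G t y) \<le> C * norm (closest_point ?K x - closest_point ?K y)"
      unfolding G_def by (rule C(2)[OF cp cp])
    also have "\<dots> \<le> C * norm (x - y)"
      using closest_point_lipschitz[OF ne(3,2,1), of x y] by (intro mult_left_mono C) (simp add: dist_norm)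
    finally show ?thesis .
  qed
  have "continuous_on UNIV (\<lambda>z. (\<lambda>(t, x). polar_field h \<sigma> t x) (fst z, closest_point ?K (snd z)))"
  proof (rule continuous_on_compose2[OF continuous_polar_field[OF lipschitz_on_continuous_on[OF h]]])
    show "continuous_on UNIV (\<lambda>z::real \<times> real \<times> real \<times> real. (fst z, closest_point ?K (snd z)))"
      by (intro continuous_intros continuous_on_compose2[OF continuous_on_closest_point[OF ne(3,2,1), of UNIV]]) auto
    show "snd (snd u) \<noteq> 0" if "u \<in> ?K" for u using c(2)[OF that] c(1) by auto
  qed (use K cp in auto)
  then have contG: "continuous_on UNIV (\<lambda>(t, x). G t x)" by (simp add: G_def case_prod_unfold)
  have "\<exists>u. u 0 = uc + s *\<^sub>R ?e \<and> (\<forall>t. (u has_vector_derivative G t (u t)) (at t))" for s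
    using picard_global[OF contG lip, of B "uc + s *\<^sub>R ?e"] C(3)[OF cp] unfolding G_def by metis
  then obtain u where u: "\<And>s. u s 0 = uc + s *\<^sub>R ?e" "\<And>s t. (u s has_vector_derivative G t (u s t)) (at t)"
    by metis
  define f where "f = (\<lambda>s. fst (snd (u s pi)) / k)"
  have end_est: "(\<forall>t\<in>{0..pi}. u s t \<in> ?K) \<and> \<bar>fst (snd (u s pi)) - s * k\<bar> \<le> \<bar>k\<bar> * \<delta> / 2" if "\<bar>s\<bar> \<le> \<delta>" for s
    using u that unfolding G_def by (intro endpoint)
  have f: "\<bar>f s - s\<bar> \<le> \<delta> / 2" if "\<bar>s\<bar> \<le> \<delta>" for s
  proof -
    have "\<bar>k\<bar> * \<bar>f s - s\<bar> \<le> \<bar>k\<bar> * (\<delta> / 2)"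
      using end_est[OF that] \<open>k \<noteq> 0\<close> by (simp add: f_def right_diff_distrib mult.commute flip: abs_mult)
    then show ?thesis using \<open>k \<noteq> 0\<close> by simp
  qed
  define E where "E = sqrt (exp ((2 * C + 1) * pi))"
  have "E-lipschitz_on UNIV (\<lambda>s. u s pi)"
  proof (rule lipschitz_onI)
    fix s s'
    have "(norm (u s pi - u s' pi))\<^sup>2 \<le> exp ((2 * C + 1) * pi) * ((norm (u s 0 - u s' 0))\<^sup>2 + 0\<^sup>2)"
    proof (rule norm_growth[where z' = "\<lambda>t. G t (u s t) - G t (u s' t)"])
      show "((\<lambda>t. u s t - u s' t) has_vector_derivative G t (u s t) - G t (u s' t)) (at t)" for t
        by (intro has_vector_derivative_diff u)
    qed (use lip C(1) in auto)
    also have "norm (u s 0 - u s' 0) = \<bar>s - s'\<bar>"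
      by (simp add: u flip: scaleR_left_diff_distrib)
    finally have "(norm (u s pi - u s' pi))\<^sup>2 \<le> (E * \<bar>s - s'\<bar>)\<^sup>2" by (simp add: E_def power_mult_distrib)
    then show "dist (u s pi) (u s' pi) \<le> E * dist s s'"
      unfolding dist_norm real_norm_def by (rule power2_le_imp_le) (simp add: E_def)
  qed (simp add: E_def)
  then have "continuous_on {-\<delta>..\<delta>} f"
    unfolding f_def using \<open>k \<noteq> 0\<close>
    by (intro continuous_intros lipschitz_on_continuous_on) (auto intro: lipschitz_on_subset)
  moreover have "\<bar>f \<delta> - \<delta>\<bar> \<le> \<delta> / 2" "\<bar>f (- \<delta>) - - \<delta>\<bar> \<le> \<delta> / 2" using \<open>\<delta> > 0\<close> by (intro f; simp)+
  then have "f (- \<delta>) \<le> 0" "0 \<le> f \<delta>" using \<open>\<delta> > 0\<close> unfolding abs_le_iff by linarith+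
  ultimately obtain s where s: "\<bar>s\<bar> \<le> \<delta>" "f s = 0"
    using IVT'[of f "- \<delta>" 0 \<delta>] \<open>\<delta> > 0\<close> by (auto simp: abs_le_iff minus_le_iff)
  have p0: "fst (snd (u s pi)) = 0" using s(2) \<open>k \<noteq> 0\<close> by (simp add: f_def)
  have flip_uc: "flip_p uc = uc" by (simp add: flip_p_def uc_def)
  have rev: "G (- t) (flip_p x) = - flip_p (G t x)" for t x
  proof -
    have "closest_point ?K (flip_p x) = flip_p (closest_point ?K x)"
      using \<open>r > 0\<close> by (intro closest_point_cball_commute dist_flip_p flip_p_flip_p flip_uc) simp
    then show ?thesis
      unfolding G_def using polar_field_reversible[of U h "closest_point ?K x" \<sigma> t, OF sym] subsetD[OF A(2) K[OF cp]]
      by simp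
  qed
  have per: "G (t + 2 * pi) x = G t x" for t x by (simp add: G_def polar_field_def)
  have "flip_p (u s 0) = u s 0" by (simp add: u flip_p_def uc_def)
  moreover have "flip_p (u s pi) = u s pi" using p0 by (cases "u s pi") (simp add: flip_p_def)
  ultimately have ev: "u s (- t) = flip_p (u s t)" and pe: "u s (t + 2 * pi) = u s t" for t
    using reversible_periodic[OF lip per linear_flip_p rev u(2), of s] by auto
  have inK: "u s t \<in> ?K" for t
  proof (rule half_period_bound[OF ev pe])
    show "u s t \<in> ?K" if "t \<in> {0..pi}" for t using end_est[OF s(1)] that by blast
    show "flip_p x \<in> ?K" if "x \<in> ?K" for x using that dist_flip_p[of uc x] flip_uc by simp
  qed simp
  show ?thesis
  proof (rule that[OF s(1), of "u s"])
    show "u s 0 = (\<rho>, 0, q0 + s)" by (simp add: u uc_def)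
    show "(u s has_vector_derivative polar_field h \<sigma> t (u s t)) (at t)" for t
      using u(2)[of s t] closest_point_self[OF inK] by (simp add: G_def)
  qed (use inK pe ev in auto)
qed

section \<open>The central field and its perturbations\<close>

text \<open>
  The polar field of the unperturbed problem; it does not depend on the angle.
\<close>
definition central_field :: "real \<Rightarrow> real \<Rightarrow> real \<times> real \<times> real \<Rightarrow> real \<times> real \<times> real" where
  "central_field \<kappa> \<alpha> = (\<lambda>(\<rho>, p, q). (p * (\<rho> / q), q - \<kappa> * \<rho> powr - \<alpha> / q, - p))"

lemma polar_field_central:
  assumes \<sigma>: "\<sigma>\<^sup>2 = 1" and "\<rho> > 0"
    and h: "h (\<rho> *\<^sub>R er \<sigma> \<theta>) = - (\<kappa> / norm (\<rho> *\<^sub>R er \<sigma> \<theta>) powr (\<alpha> + 2)) *\<^sub>R (\<rho> *\<^sub>R er \<sigma> \<theta>)"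
  shows "polar_field h \<sigma> \<theta> (\<rho>, p, q) = central_field \<kappa> \<alpha> (\<rho>, p, q)"
proof -
  have \<sigma>': "\<bar>\<sigma>\<bar> = 1" using \<sigma> by (simp add: abs_square_eq_1)
  have "er \<sigma> \<theta> \<bullet> er \<sigma> \<theta> = 1" using \<sigma>' by (simp add: dot_square_norm)
  moreover have "er \<sigma> \<theta> \<bullet> et \<sigma> \<theta> = 0" by (simp add: inner_vec2)
  moreover have "\<rho> / q * (\<kappa> / \<rho> powr (\<alpha> + 2) * \<rho>) = \<kappa> * \<rho> powr - \<alpha> / q"
  proof -
    have "\<rho> * (\<rho> * \<kappa>) / \<rho> powr (\<alpha> + 2) = \<kappa> * \<rho> powr - \<alpha>"
      using \<open>\<rho> > 0\<close> by (simp add: powr_add powr_minus power2_eq_square field_simps)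
    moreover have "\<rho> / q * (\<kappa> / \<rho> powr (\<alpha> + 2) * \<rho>) = (\<rho> * (\<rho> * \<kappa>) / \<rho> powr (\<alpha> + 2)) / q"
      by (simp add: mult_ac)
    ultimately show ?thesis by simp
  qed
  ultimately show ?thesis
    using h \<sigma>' \<open>\<rho> > 0\<close> by (simp add: polar_field_def central_field_def mult_ac)
qed

text \<open>
  The condition on \<open>q\<close> is the balance between the centripetal acceleration \<open>q\<^sup>2 / \<rho>\<close> of the circular motion and
  the attraction \<open>\<kappa> / \<rho> powr (\<alpha> + 1)\<close>.  It makes \<open>(\<rho>, 0, q)\<close> an equilibrium and eliminates \<open>\<kappa>\<close> from the
  linearization, in which \<open>y'' = - (2 - \<alpha>) y\<close>.
\<close>
lemma central_field_derivative:
  assumes "\<rho> > 0" "q > 0" and circular: "q\<^sup>2 = \<kappa> * \<rho> powr - \<alpha>"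
  shows "central_field \<kappa> \<alpha> (\<rho>, 0, q) = 0"
    and "(central_field \<kappa> \<alpha> has_derivative (\<lambda>(x, y, z). (y * (\<rho> / q), 2 * z + \<alpha> * (q / \<rho>) * x, - y)))
      (at (\<rho>, 0, q))"
proof -
  show "central_field \<kappa> \<alpha> (\<rho>, 0, q) = 0"
    using assms by (simp add: central_field_def zero_prod_def power2_eq_square flip: circular)
  have pw: "((\<lambda>u::real \<times> real \<times> real. fst u powr - \<alpha>) has_derivative (\<lambda>v. fst v * (- \<alpha> * \<rho> powr (- \<alpha> - 1)))) (at (\<rho>, 0, q))"
  proof -
    have "((\<lambda>x. x powr - \<alpha>) has_real_derivative - \<alpha> * \<rho> powr (- \<alpha> - 1)) (at \<rho>)"
      using has_real_derivative_powr[OF \<open>\<rho> > 0\<close>, of "- \<alpha>"] by simp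
    then have "((\<lambda>x. x powr - \<alpha>) has_derivative (\<lambda>h. h * (- \<alpha> * \<rho> powr (- \<alpha> - 1)))) (at (fst (\<rho>, 0::real, q)))"
      unfolding has_field_derivative_def fst_conv by (simp only: mult.commute[of _ "- \<alpha> * \<rho> powr (- \<alpha> - 1)"])
    from has_derivative_compose[OF has_derivative_fst[OF has_derivative_ident] this] show ?thesis by simp
  qed
  have p1: "\<kappa> * \<rho> powr (- \<alpha> - 1) = q\<^sup>2 / \<rho>"
    using \<open>\<rho> > 0\<close> by (simp add: powr_diff circular)
  define P where "P = (\<lambda>u::real \<times> real \<times> real. fst u powr - \<alpha>)"
  define D where "D = - \<alpha> * \<rho> powr (- \<alpha> - 1)"
  have P: "P (\<rho>, 0, q) = \<rho> powr - \<alpha>" by (simp add: P_def)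
  have dP: "(P has_derivative (\<lambda>v. fst v * D)) (at (\<rho>, 0, q))" using pw by (simp add: P_def D_def)
  have eq: "central_field \<kappa> \<alpha> = (\<lambda>u. (fst (snd u) * (fst u / snd (snd u)),
      snd (snd u) - \<kappa> * P u / snd (snd u), - fst (snd u)))"
    by (auto simp: central_field_def P_def)
  have "(central_field \<kappa> \<alpha> has_derivative (\<lambda>v. (fst (snd v) * (\<rho> / q),
      snd (snd v) - (\<kappa> * (fst v * (- \<alpha> * \<rho> powr (- \<alpha> - 1))) / q - \<kappa> * \<rho> powr - \<alpha> * snd (snd v) / (q * q)),
      - fst (snd v)))) (at (\<rho>, 0, q))"
    unfolding eq D_def[symmetric] using \<open>q > 0\<close>
    by (auto intro!: derivative_eq_intros dP simp: P field_simps)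
  moreover have "(\<lambda>v. (fst (snd v) * (\<rho> / q),
      snd (snd v) - (\<kappa> * (fst v * (- \<alpha> * \<rho> powr (- \<alpha> - 1))) / q - \<kappa> * \<rho> powr - \<alpha> * snd (snd v) / (q * q)),
      - fst (snd v))) = (\<lambda>(x, y, z). (y * (\<rho> / q), 2 * z + \<alpha> * (q / \<rho>) * x, - y))"
  proof
    fix v :: "real \<times> real \<times> real"
    obtain x y z where v: "v = (x, y, z)" by (cases v)
    have "\<kappa> * (x * (- \<alpha> * \<rho> powr (- \<alpha> - 1))) / q = - (\<alpha> * x * (\<kappa> * \<rho> powr (- \<alpha> - 1)) / q)" by simp
    also have "\<dots> = - (\<alpha> * (q / \<rho>) * x)"
      unfolding p1 using \<open>q > 0\<close> by (simp add: power2_eq_square)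
    finally have 1: "\<kappa> * (x * (- \<alpha> * \<rho> powr (- \<alpha> - 1))) / q = - (\<alpha> * (q / \<rho>) * x)" .
    have 2: "\<kappa> * \<rho> powr - \<alpha> * z / (q * q) = z"
      using \<open>q > 0\<close> by (simp add: power2_eq_square flip: circular)
    show "(fst (snd v) * (\<rho> / q),
      snd (snd v) - (\<kappa> * (fst v * (- \<alpha> * \<rho> powr (- \<alpha> - 1))) / q - \<kappa> * \<rho> powr - \<alpha> * snd (snd v) / (q * q)),
      - fst (snd v)) = (case v of (x, y, z) \<Rightarrow> (y * (\<rho> / q), 2 * z + \<alpha> * (q / \<rho>) * x, - y))"
      unfolding v fst_conv snd_conv prod.case 1 2 by simp
  qed
  ultimately show "(central_field \<kappa> \<alpha> has_derivative (\<lambda>(x, y, z). (y * (\<rho> / q), 2 * z + \<alpha> * (q / \<rho>) * x, - y)))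
      (at (\<rho>, 0, q))" by simp
qed

lemma norm_polar_field_diff_le:
  assumes \<sigma>: "\<bar>\<sigma>\<bar> = 1" and "fst u > 0" "snd (snd u) > 0"
    and e: "norm (h (fst u *\<^sub>R er \<sigma> \<theta>) - h' (fst u *\<^sub>R er \<sigma> \<theta>)) \<le> e"
  shows "norm (polar_field h \<sigma> \<theta> u - polar_field h' \<sigma> \<theta> u) \<le> 2 * (fst u / snd (snd u)) * e"
proof -
  obtain \<rho> p q where u: "u = (\<rho>, p, q)" by (cases u)
  let ?\<Delta> = "h (\<rho> *\<^sub>R er \<sigma> \<theta>) - h' (\<rho> *\<^sub>R er \<sigma> \<theta>)"
  have "polar_field h \<sigma> \<theta> u - polar_field h' \<sigma> \<theta> u = (0, \<rho> / q * (?\<Delta> \<bullet> er \<sigma> \<theta>), \<rho> / q * (?\<Delta> \<bullet> et \<sigma> \<theta>))"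
    by (simp add: u polar_field_def inner_diff_left right_diff_distrib)
  also have "norm \<dots> \<le> norm (\<rho> / q * (?\<Delta> \<bullet> er \<sigma> \<theta>)) + norm (\<rho> / q * (?\<Delta> \<bullet> et \<sigma> \<theta>))"
    using norm_Pair_le[of "0::real" "(\<rho> / q * (?\<Delta> \<bullet> er \<sigma> \<theta>), \<rho> / q * (?\<Delta> \<bullet> et \<sigma> \<theta>))"]
      norm_Pair_le[of "\<rho> / q * (?\<Delta> \<bullet> er \<sigma> \<theta>)" "\<rho> / q * (?\<Delta> \<bullet> et \<sigma> \<theta>)"] by simp
  also have "\<dots> \<le> \<rho> / q * e + \<rho> / q * e"
  proof -
    have "\<bar>?\<Delta> \<bullet> er \<sigma> \<theta>\<bar> \<le> e" "\<bar>?\<Delta> \<bullet> et \<sigma> \<theta>\<bar> \<le> e"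
      using Cauchy_Schwarz_ineq2[of ?\<Delta> "er \<sigma> \<theta>"] Cauchy_Schwarz_ineq2[of ?\<Delta> "et \<sigma> \<theta>"] e \<sigma> by (auto simp: u)
    then show ?thesis
      unfolding real_norm_def abs_mult using assms(2,3)
      by (intro add_mono mult_mono) (auto simp: u)
  qed
  finally show ?thesis by (simp add: u)
qed

lemma uniform_near_parameter:
  fixes g :: "'a::metric_space \<Rightarrow> real \<Rightarrow> 'b::metric_space"
  assumes cont: "continuous_on (U \<times> {-a<..<a}) (\<lambda>(r, \<mu>). g r \<mu>)" and "compact A" "A \<subseteq> U" "a > 0" "e > 0"
  obtains \<delta>0 where "0 < \<delta>0" "\<delta>0 < a" "\<And>\<mu> x. \<bar>\<mu>\<bar> < \<delta>0 \<Longrightarrow> x \<in> A \<Longrightarrow> dist (g x \<mu>) (g x 0) < e"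
proof -
  let ?C = "A \<times> {-(a/2)..a/2}"
  have "continuous_on ?C (\<lambda>(r, \<mu>). g r \<mu>)"
    by (rule continuous_on_subset[OF cont]) (use assms in auto)
  then have "uniformly_continuous_on ?C (\<lambda>(r, \<mu>). g r \<mu>)"
    by (intro compact_uniformly_continuous compact_Times assms) auto
  then obtain d where d: "d > 0"
    "\<And>z z'. z \<in> ?C \<Longrightarrow> z' \<in> ?C \<Longrightarrow> dist z' z < d \<Longrightarrow> dist ((\<lambda>(r, \<mu>). g r \<mu>) z') ((\<lambda>(r, \<mu>). g r \<mu>) z) < e"
    unfolding uniformly_continuous_on_def using \<open>e > 0\<close> by blast
  show ?thesis
  proof (rule that[of "min d (a / 2)"])
    fix \<mu> x assume "\<bar>\<mu>\<bar> < min d (a / 2)" "x \<in> A"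
    then have "(x, 0) \<in> ?C" "(x, \<mu>) \<in> ?C" "dist (x, \<mu>) (x, 0) < d"
      using \<open>a > 0\<close> by (auto simp: dist_Pair_Pair)
    then show "dist (g x \<mu>) (g x 0) < e"
      using d(2)[of "(x, 0)" "(x, \<mu>)"] by simp
  qed (use d assms in auto)
qed

lemma annulus_in_neighbourhood:
  fixes U :: "'a::euclidean_space set"
  assumes "open U" "sphere 0 \<rho> \<subseteq> U" "\<rho> > 0"
  obtains d where "d > 0" "{x::'a. \<bar>norm x - \<rho>\<bar> \<le> d} \<subseteq> U"
proof -
  obtain e where e: "e > 0" "(\<Union>x\<in>sphere 0 \<rho>. cball x e) \<subseteq> U"
    using compact_subset_open_imp_cball_epsilon_subset[OF compact_sphere assms(1,2)] by blast
  show ?thesis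
  proof (rule that[of "min e (\<rho> / 2)"])
    show "{x::'a. \<bar>norm x - \<rho>\<bar> \<le> min e (\<rho> / 2)} \<subseteq> U"
    proof
      fix x :: 'a assume "x \<in> {x. \<bar>norm x - \<rho>\<bar> \<le> min e (\<rho> / 2)}"
      then have x: "\<bar>norm x - \<rho>\<bar> \<le> e" "norm x > 0" using \<open>\<rho> > 0\<close> by auto
      let ?y = "(\<rho> / norm x) *\<^sub>R x"
      have "?y - x = ((\<rho> - norm x) / norm x) *\<^sub>R x"
        using x(2) by (simp add: diff_divide_distrib scaleR_left_diff_distrib)
      then have "dist ?y x = \<bar>norm x - \<rho>\<bar>" using x(2) by (simp add: dist_norm abs_minus_commute)
      then have "x \<in> cball ?y e" using x(1) by simp
      moreover have "?y \<in> sphere 0 \<rho>" using x(2) \<open>\<rho> > 0\<close> by simp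
      ultimately show "x \<in> U" using e(2) by blast
    qed
  qed (use e \<open>\<rho> > 0\<close> in auto)
qed

section \<open>Periodic orbits near the circle\<close>

text \<open>
  The speed \<open>q0\<close> is that of the circular orbit.  The bound on \<open>s\<close> is the shooting range \<open>\<delta>\<close>, which is
  chosen below \<open>\<eta>\<close> first; the range of \<open>\<mu>\<close> then has to be so small that the perturbation cannot
  destroy the sign change at the ends of the shooting range.
\<close>
lemma perturbed_periodic_orbits:
  fixes U :: "(real^2) set" and \<rho> a \<kappa> \<alpha> \<sigma> \<eta> :: real
    and g :: "real^2 \<Rightarrow> real \<Rightarrow> real^2"
  assumes "\<rho> > 0" and \<sigma>: "\<sigma>\<^sup>2 = 1"
    and U: "open U" "sphere 0 \<rho> \<subseteq> U"
    and "a > 0"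
    and cont: "continuous_on (U \<times> {-a<..<a}) (\<lambda>(r, \<mu>). g r \<mu>)"
    and "\<kappa> > 0" and \<alpha>: "\<alpha> \<ge> 0" "\<alpha> \<noteq> 1"
    and central: "\<And>r. r \<in> U \<Longrightarrow> g r 0 = - (\<kappa> / norm r powr (\<alpha> + 2)) *\<^sub>R r"
    and C1: "\<And>\<mu>. \<mu> \<in> {-a<..<a} \<Longrightarrow> C1_on (\<lambda>r. g r \<mu>) U"
    and sym: "\<And>\<mu> r. \<mu> \<in> {-a<..<a} \<Longrightarrow> r \<in> U \<Longrightarrow> g (reflect_x r) \<mu> = reflect_x (g r \<mu>)"
    and "\<eta> > 0"
  obtains \<delta>0 q0 where "0 < \<delta>0" "\<delta>0 < a"
    "\<And>\<mu>. \<bar>\<mu>\<bar> < \<delta>0 \<Longrightarrow> \<exists>s r. \<bar>s\<bar> < \<eta> \<and>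
        solves_ivp U (\<lambda>x. g x \<mu>) (\<rho> *\<^sub>R er \<sigma> 0) ((q0 + s) *\<^sub>R et \<sigma> 0) r \<and> periodic r \<and>
        simple_closed_curve (range r) \<and> reflect_x ` range r = range r \<and> encloses (range r) 0"
proof -
  define q0 where "q0 = sqrt (\<kappa> * \<rho> powr - \<alpha>)"
  have q0: "q0 > 0" "q0\<^sup>2 = \<kappa> * \<rho> powr - \<alpha>" using \<open>\<kappa> > 0\<close> \<open>\<rho> > 0\<close> by (auto simp: q0_def)
  have \<sigma>': "\<bar>\<sigma>\<bar> = 1" using \<sigma> by (simp add: abs_square_eq_1)
  define uc where "uc = (\<rho>, 0::real, q0)"
  obtain d1 where d1: "d1 > 0" "{x. \<bar>norm x - \<rho>\<bar> \<le> d1} \<subseteq> U"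
    using annulus_in_neighbourhood[OF U \<open>\<rho> > 0\<close>] by blast
  define d where "d = min d1 (min (\<rho> / 2) (q0 / 2))"
  have d: "d > 0" "d \<le> d1" "d \<le> \<rho> / 2" "d \<le> q0 / 2" using d1 q0 \<open>\<rho> > 0\<close> by (auto simp: d_def)
  define A :: "(real^2) set" where "A = {x. \<bar>norm x - \<rho>\<bar> \<le> d}"
  have AU: "A \<subseteq> U" using d1(2) d(2) by (auto simp: A_def)
  have cA: "compact A"
  proof -
    have "A = cball 0 (\<rho> + d) - ball 0 (\<rho> - d)" by (auto simp: A_def abs_le_iff)
    then show ?thesis by (simp add: compact_diff)
  qed
  have box: "\<bar>fst u - \<rho>\<bar> \<le> d" "\<bar>snd (snd u) - q0\<bar> \<le> d" if "u \<in> cball uc d" for u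
  proof -
    have "dist u uc \<le> d" using that by (simp add: dist_commute)
    then show "\<bar>fst u - \<rho>\<bar> \<le> d" "\<bar>snd (snd u) - q0\<bar> \<le> d"
      using dist_fst_le[of u uc] dist_snd_le[of u uc] dist_snd_le[of "snd u" "snd uc"]
      by (auto simp: uc_def dist_real_def)
  qed
  have pos: "\<rho> / 2 \<le> fst u" "fst u \<le> 3 / 2 * \<rho>" "q0 / 2 \<le> snd (snd u)" "snd (snd u) \<le> 3 / 2 * q0"
    if "u \<in> cball uc d" for u
    using box[OF that] d unfolding abs_le_iff by linarith+
  have inA: "fst u *\<^sub>R er \<sigma> \<theta> \<in> A" if "u \<in> cball uc d" for u \<theta>
    using box(1)[OF that] pos(1)[OF that] \<open>\<rho> > 0\<close> \<sigma>' by (simp add: A_def)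
  obtain S C where SC: "S 0 = 0" "C 0 = 1" "\<And>t. (S has_real_derivative C t) (at t)"
    "\<And>t. (C has_real_derivative - (2 - \<alpha>) * S t) (at t)" "S pi \<noteq> 0"
    using oscillator_solution[of "2 - \<alpha>"] \<alpha> by auto
  \<comment> \<open>the solution of the adjoint equation that ends in \<open>(0, 1, 0)\<close>, so that the inner product with it
    at \<open>pi\<close> extracts the radial velocity\<close>
  define \<phi> where "\<phi> = (\<lambda>t. (\<alpha> * (q0 / \<rho>) * S (pi - t), C (pi - t), 2 * S (pi - t)))"
  define \<phi>' where "\<phi>' = (\<lambda>t. (- \<alpha> * (q0 / \<rho>) * C (pi - t), (2 - \<alpha>) * S (pi - t), - 2 * C (pi - t)))"
  have rev: "((\<lambda>t. f (pi - t)) has_real_derivative - f' (pi - t)) (at t)"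
    if "\<And>t. (f has_real_derivative f' t) (at t)" for f f' :: "real \<Rightarrow> real" and t
  proof -
    have "((\<lambda>t. pi - t) has_real_derivative - 1) (at t)" by (auto intro!: derivative_eq_intros)
    from DERIV_chain2[where f = f, OF that this] show ?thesis by simp
  qed
  have dS: "((\<lambda>t. S (pi - t)) has_real_derivative - C (pi - t)) (at t)" for t by (rule rev[OF SC(3)])
  have dC: "((\<lambda>t. C (pi - t)) has_real_derivative (2 - \<alpha>) * S (pi - t)) (at t)" for t
    using rev[OF SC(4), of t] by (simp only: mult_minus_left minus_minus)
  have \<phi>: "(\<phi> has_vector_derivative \<phi>' t) (at t)" for t
    unfolding \<phi>_def \<phi>'_def
    using DERIV_cmult[OF dS, of "\<alpha> * (q0 / \<rho>)" t] DERIV_cmult[OF dS, of 2 t] dC[of t]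
    by (intro has_vector_derivative_Pair) (simp_all add: has_real_derivative_iff_has_vector_derivative)
  let ?A = "\<lambda>(x, y, z). (y * (\<rho> / q0), 2 * z + \<alpha> * (q0 / \<rho>) * x, - y)"
  have adj: "\<phi>' t \<bullet> w + \<phi> t \<bullet> ?A w = 0" for t w
  proof -
    obtain x y z where w: "w = (x, y, z)" by (cases w)
    show ?thesis using \<open>\<rho> > 0\<close> q0(1) by (simp add: w \<phi>_def \<phi>'_def field_simps)
  qed
  note der = central_field_derivative[OF \<open>\<rho> > 0\<close> q0, folded uc_def]
  define k where "k = 2 * S pi"
  have k: "k \<noteq> 0" "\<phi> 0 \<bullet> (0, 0, 1) = k" using SC(5) by (auto simp: k_def \<phi>_def)
  have ne: "norm (0::real, 0::real, 1::real) = 1" by (simp add: norm_Pair)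
  obtain r \<delta> \<epsilon> where r: "0 < r" "r \<le> d" and \<delta>: "0 < \<delta>" "\<delta> < \<eta>" and \<epsilon>: "0 < \<epsilon>"
    and est: "\<And>H u s. (\<And>t w. t \<in> {0..pi} \<Longrightarrow> w \<in> cball uc r \<Longrightarrow> norm (H t w - central_field \<kappa> \<alpha> w) \<le> \<epsilon>) \<Longrightarrow>
      (\<And>t. t \<in> {0..pi} \<Longrightarrow> (u has_vector_derivative H t (closest_point (cball uc r) (u t))) (at t)) \<Longrightarrow>
      u 0 = uc + s *\<^sub>R (0, 0, 1) \<Longrightarrow> \<bar>s\<bar> \<le> \<delta> \<Longrightarrow>
      (\<forall>t\<in>{0..pi}. u t \<in> cball uc r) \<and> \<bar>\<phi> pi \<bullet> (u pi - uc) - s * (\<phi> 0 \<bullet> (0, 0, 1))\<bar> \<le> \<bar>\<phi> 0 \<bullet> (0, 0, 1)\<bar> * \<delta> / 2"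
    by (rule adjoint_endpoint_estimate[OF der(2,1) \<phi> adj ne _ pi_gt_zero \<open>\<eta> > 0\<close> d(1)])
      (use k in auto)
  have sub: "cball uc r \<subseteq> cball uc d" using r(2) by auto
  \<comment> \<open>on the box around \<open>uc\<close> the factor \<open>2 \<rho> / q\<close> in \<open>norm_polar_field_diff_le\<close> is at most \<open>6 \<rho> / q0\<close>,
    which explains the constant\<close>
  obtain \<delta>0 where \<delta>0: "0 < \<delta>0" "\<delta>0 < a"
    "\<And>\<mu> x. \<bar>\<mu>\<bar> < \<delta>0 \<Longrightarrow> x \<in> A \<Longrightarrow> dist (g x \<mu>) (g x 0) < \<epsilon> * q0 / (6 * \<rho>)"
    using uniform_near_parameter[OF cont cA AU \<open>a > 0\<close>, of "\<epsilon> * q0 / (6 * \<rho>)"] \<epsilon> q0 \<open>\<rho> > 0\<close> by auto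
  show ?thesis
  proof (rule that[OF \<delta>0(1,2)])
    fix \<mu> :: real assume \<mu>: "\<bar>\<mu>\<bar> < \<delta>0"
    then have \<mu>a: "\<mu> \<in> {-a<..<a}" using \<delta>0(2) by auto
    let ?h = "\<lambda>x. g x \<mu>"
    have near: "norm (polar_field ?h \<sigma> t w - central_field \<kappa> \<alpha> w) \<le> \<epsilon>" if "w \<in> cball uc r" for t w
    proof -
      have w: "w \<in> cball uc d" using that sub by blast
      have "polar_field (\<lambda>x. g x 0) \<sigma> t w = central_field \<kappa> \<alpha> w"
        using polar_field_central[OF \<sigma>, of "fst w" "\<lambda>x. g x 0" t \<kappa> \<alpha> "fst (snd w)" "snd (snd w)"]
          central[OF subsetD[OF AU inA[OF w]], of t] pos(1)[OF w] \<open>\<rho> > 0\<close> by simp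
      moreover have "norm (polar_field ?h \<sigma> t w - polar_field (\<lambda>x. g x 0) \<sigma> t w)
          \<le> 2 * (fst w / snd (snd w)) * (\<epsilon> * q0 / (6 * \<rho>))"
        using pos[OF w] \<open>\<rho> > 0\<close> q0(1) \<delta>0(3)[OF \<mu> inA[OF w], of t]
        by (intro norm_polar_field_diff_le \<sigma>') (auto simp: dist_norm)
      moreover have "2 * (fst w / snd (snd w)) * (\<epsilon> * q0 / (6 * \<rho>)) \<le> 2 * ((3 / 2 * \<rho>) / (q0 / 2)) * (\<epsilon> * q0 / (6 * \<rho>))"
        using pos[OF w] \<open>\<rho> > 0\<close> q0(1) \<epsilon>
        by (intro mult_right_mono mult_left_mono frac_le) auto
      moreover have "2 * ((3 / 2 * \<rho>) / (q0 / 2)) * (\<epsilon> * q0 / (6 * \<rho>)) = \<epsilon>"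
        using \<open>\<rho> > 0\<close> q0(1) by simp
      ultimately show ?thesis by simp
    qed
    obtain L where L: "L-lipschitz_on A ?h"
      using C1_on_lipschitz_on_compact[OF C1[OF \<mu>a] U(1) cA AU] .
    obtain s u where s: "\<bar>s\<bar> \<le> \<delta>" and u0: "u 0 = (\<rho>, 0, q0 + s)"
      and u: "\<And>t. (u has_vector_derivative polar_field ?h \<sigma> t (u t)) (at t)" "\<And>t. u t \<in> cball uc r"
      "\<And>t. u (t + 2 * pi) = u t" "\<And>t. u (- t) = flip_p (u t)"
    proof (rule periodic_polar_orbit[OF \<sigma>' L cA AU _ r(1)])
      show "g (reflect_x x) \<mu> = reflect_x (g x \<mu>)" if "x \<in> U" for x by (rule sym[OF \<mu>a that])
      show "0 < q0 / 2" "0 < \<delta>" "k \<noteq> 0" using q0 \<delta> k by auto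
      show "fst v *\<^sub>R er \<sigma> \<theta> \<in> A" "q0 / 2 \<le> snd (snd v)" if "v \<in> cball (\<rho>, 0::real, q0) r" for v \<theta>
      proof -
        have "v \<in> cball uc d" using that sub unfolding uc_def by blast
        then show "fst v *\<^sub>R er \<sigma> \<theta> \<in> A" "q0 / 2 \<le> snd (snd v)" by (simp_all only: inA pos(3))
      qed
      fix v s
      assume v: "\<And>t. t \<in> {0..pi} \<Longrightarrow>
          (v has_vector_derivative polar_field ?h \<sigma> t (closest_point (cball (\<rho>, 0, q0) r) (v t))) (at t)"
        "v 0 = (\<rho>, 0, q0) + s *\<^sub>R (0, 0, 1)" "\<bar>s\<bar> \<le> \<delta>"
      have "\<phi> pi \<bullet> (v pi - uc) = fst (snd (v pi))"
        by (cases "v pi") (simp add: \<phi>_def SC uc_def)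
      then show "(\<forall>t\<in>{0..pi}. v t \<in> cball (\<rho>, 0, q0) r) \<and> \<bar>fst (snd (v pi)) - s * k\<bar> \<le> \<bar>k\<bar> * \<delta> / 2"
        using est[of "polar_field ?h \<sigma>" v s, OF near] v k(2) unfolding uc_def by simp
    qed (rule that[unfolded uc_def])
    have ud: "u t \<in> cball uc d" for t using u(2) sub by blast
    obtain x where x: "solves_ivp U ?h (fst (u 0) *\<^sub>R er \<sigma> 0) (fst (snd (u 0)) *\<^sub>R er \<sigma> 0 + snd (snd (u 0)) *\<^sub>R et \<sigma> 0) x"
      "periodic x" "range x = range (\<lambda>\<theta>. fst (u \<theta>) *\<^sub>R er \<sigma> \<theta>)"
    proof (rule solution_from_polar[OF \<sigma> u(1,3)])
      show "0 < \<rho> / 2" using \<open>\<rho> > 0\<close> by simp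
      show "\<rho> / 2 \<le> fst (u \<theta>)" "0 < snd (snd (u \<theta>))" "snd (snd (u \<theta>)) \<le> 3 / 2 * q0"
        "fst (u \<theta>) *\<^sub>R er \<sigma> \<theta> \<in> U" for \<theta>
        using pos[OF ud[of \<theta>]] q0(1) inA[OF ud[of \<theta>]] AU by auto
    qed (rule that)
    interpret polar_graph \<sigma> "\<lambda>\<theta>. fst (u \<theta>)"
    proof
      show "continuous_on UNIV (\<lambda>\<theta>. fst (u \<theta>))"
        using u(1) has_vector_derivative_continuous
        by (intro continuous_intros) (blast intro: continuous_at_imp_continuous_on)
      show "0 < fst (u \<theta>)" for \<theta> using pos(1)[OF ud[of \<theta>]] \<open>\<rho> > 0\<close> by simp
    qed (use \<sigma> u(3) in auto)
    have rx: "range x = range X" unfolding x(3) by (simp add: X_def)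
    have "fst (u (- \<theta>)) = fst (u \<theta>)" for \<theta> by (simp add: u(4) flip_p_def split: prod.split)
    then have "reflect_x ` range x = range x" unfolding rx by (rule reflect_range)
    moreover have "\<bar>s\<bar> < \<eta>" using s \<delta> by simp
    moreover have "solves_ivp U ?h (\<rho> *\<^sub>R er \<sigma> 0) ((q0 + s) *\<^sub>R et \<sigma> 0) x"
      using x(1) unfolding u0 by simp
    moreover have "simple_closed_curve (range x)" "encloses (range x) 0"
      unfolding rx by (rule simple_closed, rule encloses_0)
    ultimately show "\<exists>s r. \<bar>s\<bar> < \<eta> \<and>
        solves_ivp U ?h (\<rho> *\<^sub>R er \<sigma> 0) ((q0 + s) *\<^sub>R et \<sigma> 0) r \<and> periodic r \<and>
        simple_closed_curve (range r) \<and> reflect_x ` range r = range r \<and> encloses (range r) 0"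
      using x(2) by blast
  qed
qed

theorem theorem0p2:
  fixes U :: "(real^2) set" and x0 :: "real^2" and \<rho> a \<kappa> \<alpha> :: real
    and g :: "real^2 \<Rightarrow> real \<Rightarrow> real^2"
  assumes "\<rho> > 0"
    and "x0 \<in> sphere 0 \<rho>" and "x0 $ 2 = 0"
    and "open U" and "sphere 0 \<rho> \<subseteq> U" and "U \<subseteq> - {0}"
    and "a > 0"
    and "continuous_on (U \<times> {-a<..<a}) (\<lambda>(r, \<mu>). g r \<mu>)"
    and "\<kappa> > 0" and "\<alpha> \<ge> 0" and "\<alpha> \<noteq> 1"
    and "\<And>r. r \<in> U \<Longrightarrow> g r 0 = - (\<kappa> / norm r powr (\<alpha> + 2)) *\<^sub>R r"
    and "\<And>\<mu>. \<mu> \<in> {-a<..<a} \<Longrightarrow> C1_on (\<lambda>r. g r \<mu>) U"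
    and "reflect_x ` U = U"
    and "\<And>\<mu> r. \<mu> \<in> {-a<..<a} \<Longrightarrow> r \<in> U \<Longrightarrow> g (reflect_x r) \<mu> = reflect_x (g r \<mu>)"
  shows "(\<exists>\<delta>0. 0 < \<delta>0 \<and> \<delta>0 < a \<and>
            (\<forall>\<mu>\<in>{-\<delta>0<..<\<delta>0}. \<exists>v r. solves_ivp U (\<lambda>x. g x \<mu>) x0 v r \<and> periodic r))
       \<and> (\<forall>\<eta>>0. \<exists>\<delta>0. 0 < \<delta>0 \<and> \<delta>0 < a \<and>
            (\<exists>v :: real \<Rightarrow> real^2.
               (\<forall>\<mu>\<in>{-\<delta>0<..<\<delta>0}. \<exists>r.
                  solves_ivp U (\<lambda>x. g x \<mu>) x0 (v \<mu>) r \<and> periodic r \<and>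
                  simple_closed_curve (range r) \<and>
                  reflect_x ` range r = range r \<and>
                  encloses (range r) 0) \<and>
               (\<forall>\<mu>\<in>{-\<delta>0<..<\<delta>0}. \<forall>\<mu>'\<in>{-\<delta>0<..<\<delta>0}. norm (v \<mu> - v \<mu>') < \<eta>)))"
proof -
  define \<sigma> where "\<sigma> = x0 $ 1 / \<rho>"
  have "(x0 $ 1)\<^sup>2 = \<rho>\<^sup>2"
    using assms(2,3) power2_norm_eq_inner[of x0] by (simp add: inner_vec2 power2_eq_square)
  then have \<sigma>: "\<sigma>\<^sup>2 = 1" using \<open>\<rho> > 0\<close> by (simp add: \<sigma>_def power_divide)
  have x0: "\<rho> *\<^sub>R er \<sigma> 0 = x0" using assms(1,3) by (simp add: vec2_eq_iff \<sigma>_def)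
  have main: "\<exists>\<delta>0. 0 < \<delta>0 \<and> \<delta>0 < a \<and> (\<exists>v :: real \<Rightarrow> real^2.
      (\<forall>\<mu>\<in>{-\<delta>0<..<\<delta>0}. \<exists>r.
          solves_ivp U (\<lambda>x. g x \<mu>) x0 (v \<mu>) r \<and> periodic r \<and>
          simple_closed_curve (range r) \<and> reflect_x ` range r = range r \<and> encloses (range r) 0) \<and>
      (\<forall>\<mu>\<in>{-\<delta>0<..<\<delta>0}. \<forall>\<mu>'\<in>{-\<delta>0<..<\<delta>0}. norm (v \<mu> - v \<mu>') < \<eta>))" if \<eta>: "\<eta> > 0" for \<eta>
  proof -
    obtain \<delta>0 q0 where \<delta>0: "0 < \<delta>0" "\<delta>0 < a" and
      ex: "\<And>\<mu>. \<bar>\<mu>\<bar> < \<delta>0 \<Longrightarrow> \<exists>s r. \<bar>s\<bar> < \<eta> / 2 \<and>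
        solves_ivp U (\<lambda>x. g x \<mu>) x0 ((q0 + s) *\<^sub>R et \<sigma> 0) r \<and> periodic r \<and>
        simple_closed_curve (range r) \<and> reflect_x ` range r = range r \<and> encloses (range r) 0"
      by (rule perturbed_periodic_orbits[OF assms(1) \<sigma> assms(4,5,7,8,9,10,11,12,13,15), of "\<eta> / 2"])
        (use \<eta> x0 in auto)
    have "\<forall>\<mu>. \<exists>s. \<bar>\<mu>\<bar> < \<delta>0 \<longrightarrow> \<bar>s\<bar> < \<eta> / 2 \<and> (\<exists>r.
        solves_ivp U (\<lambda>x. g x \<mu>) x0 ((q0 + s) *\<^sub>R et \<sigma> 0) r \<and> periodic r \<and>
        simple_closed_curve (range r) \<and> reflect_x ` range r = range r \<and> encloses (range r) 0)"
      using ex by blast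
    then have "\<exists>s. \<forall>\<mu>. \<bar>\<mu>\<bar> < \<delta>0 \<longrightarrow> \<bar>s \<mu>\<bar> < \<eta> / 2 \<and> (\<exists>r.
        solves_ivp U (\<lambda>x. g x \<mu>) x0 ((q0 + s \<mu>) *\<^sub>R et \<sigma> 0) r \<and> periodic r \<and>
        simple_closed_curve (range r) \<and> reflect_x ` range r = range r \<and> encloses (range r) 0)"
      by (rule choice)
    then obtain s where s: "\<And>\<mu>. \<bar>\<mu>\<bar> < \<delta>0 \<Longrightarrow> \<bar>s \<mu>\<bar> < \<eta> / 2 \<and> (\<exists>r.
        solves_ivp U (\<lambda>x. g x \<mu>) x0 ((q0 + s \<mu>) *\<^sub>R et \<sigma> 0) r \<and> periodic r \<and>
        simple_closed_curve (range r) \<and> reflect_x ` range r = range r \<and> encloses (range r) 0)"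
      by blast
    define v where "v = (\<lambda>\<mu>. (q0 + s \<mu>) *\<^sub>R et \<sigma> 0)"
    have "norm (v \<mu> - v \<mu>') < \<eta>" if "\<mu> \<in> {-\<delta>0<..<\<delta>0}" "\<mu>' \<in> {-\<delta>0<..<\<delta>0}" for \<mu> \<mu>'
    proof -
      have "v \<mu> - v \<mu>' = (s \<mu> - s \<mu>') *\<^sub>R et \<sigma> 0" by (simp add: v_def algebra_simps)
      then have "norm (v \<mu> - v \<mu>') = \<bar>s \<mu> - s \<mu>'\<bar>" using \<sigma> by (simp add: abs_square_eq_1)
      moreover have "\<bar>s \<mu>\<bar> < \<eta> / 2" "\<bar>s \<mu>'\<bar> < \<eta> / 2" using s[of \<mu>] s[of \<mu>'] that by (auto simp: abs_less_iff)
      ultimately show ?thesis by linarith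
    qed
    moreover have "\<forall>\<mu>\<in>{-\<delta>0<..<\<delta>0}. \<exists>r. solves_ivp U (\<lambda>x. g x \<mu>) x0 (v \<mu>) r \<and> periodic r \<and>
        simple_closed_curve (range r) \<and> reflect_x ` range r = range r \<and> encloses (range r) 0"
      using s by (auto simp: v_def abs_less_iff)
    ultimately show ?thesis using \<delta>0 by blast
  qed
  show ?thesis
  proof (intro conjI allI impI)
    show "\<exists>\<delta>0. 0 < \<delta>0 \<and> \<delta>0 < a \<and>
        (\<forall>\<mu>\<in>{-\<delta>0<..<\<delta>0}. \<exists>v r. solves_ivp U (\<lambda>x. g x \<mu>) x0 v r \<and> periodic r)"
      using main[of 1] by (meson zero_less_one)
  qed (rule main)
qed

end
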